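(* Let $\phi:G\to H$ be a homomorphism between two Riemannian Lie groups. Then: (i) If the metric on $G$ is bi-invariant and $\phi$ is a submersion, then $\phi$ is harmonic. (ii) If the metric on $H$ is bi-invariant, then $\phi$ is biharmonic, and it is harmonic when the Lie algebra $\mathfrak g$ of $G$ is unimodular.
   Context: All Lie groups are real and connected. A Riemannian Lie group is a Lie group with a left invariant Riemannian metric; the metric is bi-invariant if it is also right invariant. $\mathfrak g$ is unimodular if $\mathrm{tr}(\mathrm{ad}_u)=0$ for all $u\in\mathfrak g$. For a smooth map $\phi:(M,g)\to(N,h)$ of Riemannian manifolds and a local orthonormal frame $(E_i)$ of $TM$, the tension field is $\tau(\phi)=\sum_i(\nabla_{E_i}d\phi)(E_i)$, and the bitension field is $\tau_2(\phi)=-\sum_i\big((\nabla^\phi)^2_{E_i,E_i}\tau(\phi)+R^N(\tau(\phi),d\phi(E_i))d\phi(E_i)\big)$, where $\nabla^\phi$ is the pull-back of the Levi-Civita connection of $N$, $(\nabla^\phi)^2_{X,Y}=\nabla^\phi_X\nabla^\phi_Y-\nabla^\phi_{\nabla^M_XY}$ and $R^N(X,Y)=\nabla_X\nabla_Y-\nabla_Y\nabla_X-\nabla_{[X,Y]}$. The map $\phi$ is harmonic if $\tau(\phi)=0$ and biharmonic if $\tau_2(\phi)=0$. *)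

theory Defs
  imports "HOL-Analysis.Analysis" "HOL-Algebra.Group"
begin

section \<open>Smooth manifolds\<close>

text \<open>The map \<open>f\<close> is of class \<open>C\<^sup>k\<close> on the open set \<open>S\<close>. Only finite-dimensional domains are
  used below, where this is the usual notion.\<close>

fun C_k_on :: "nat \<Rightarrow> 'e set \<Rightarrow> ('e::real_normed_vector \<Rightarrow> 'f::real_normed_vector) \<Rightarrow> bool" where
  "C_k_on 0 S f \<longleftrightarrow> continuous_on S f"
| "C_k_on (Suc k) S f \<longleftrightarrow> (\<forall>x\<in>S. f differentiable (at x)) \<and>
     (\<forall>v. C_k_on k S (\<lambda>x. frechet_derivative f (at x) v))"

definition smooth_on :: "'e set \<Rightarrow> ('e::real_normed_vector \<Rightarrow> 'f::real_normed_vector) \<Rightarrow> bool" where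
  "smooth_on S f \<longleftrightarrow> (\<forall>k. C_k_on k S f)"

text \<open>A chart is a pair of its domain and its coordinate map; the values of the coordinate map
  outside of the domain are irrelevant. Manifolds are modelled on a finite-dimensional inner product
  space \<open>'e\<close>. Class \<^class>\<open>real_inner\<close> is used together with an explicit assumption of finite
  dimension, because \<^class>\<open>euclidean_space\<close> excludes dimension 0.\<close>

type_synonym ('a, 'e) chart = "'a set \<times> ('a \<Rightarrow> 'e)"

abbreviation chart_inv :: "('a, 'e) chart \<Rightarrow> 'e \<Rightarrow> 'a" where
  "chart_inv c \<equiv> inv_into (fst c) (snd c)"

definition is_chart :: "('a::topological_space, 'e::real_inner) chart \<Rightarrow> bool" where
  "is_chart c \<longleftrightarrow> open (fst c) \<and> open (snd c ` fst c) \<and>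
     homeomorphism (fst c) (snd c ` fst c) (snd c) (chart_inv c)"

text \<open>A manifold is the whole type \<open>'a\<close>, whose class provides the Hausdorff property and second
  countability, with an atlas, which need not be maximal.\<close>

definition smooth_atlas ::
    "('a::{t2_space,second_countable_topology}, 'e::real_inner) chart set \<Rightarrow> bool" where
  "smooth_atlas A \<longleftrightarrow>
     (\<exists>B::'e set. finite B \<and> span B = UNIV) \<and>
     (\<forall>c\<in>A. is_chart c) \<and> (\<Union>c\<in>A. fst c) = UNIV \<and>
     (\<forall>c\<in>A. \<forall>d\<in>A. smooth_on (snd c ` (fst c \<inter> fst d)) (snd d \<circ> chart_inv c))"

definition smooth_map ::
    "('a::topological_space, 'e::real_inner) chart set \<Rightarrow>
     ('b::topological_space, 'f::real_inner) chart set \<Rightarrow> ('a \<Rightarrow> 'b) \<Rightarrow> bool" where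
  "smooth_map A B \<phi> \<longleftrightarrow> continuous_on UNIV \<phi> \<and>
     (\<forall>c\<in>A. \<forall>d\<in>B. smooth_on (snd c ` (fst c \<inter> \<phi> -` fst d)) (snd d \<circ> \<phi> \<circ> chart_inv c))"

definition product_atlas ::
    "('a, 'e) chart set \<Rightarrow> ('b, 'f) chart set \<Rightarrow> ('a \<times> 'b, 'e \<times> 'f) chart set" where
  "product_atlas A B = {(fst c \<times> fst d, map_prod (snd c) (snd d)) | c d. c \<in> A \<and> d \<in> B}"

section \<open>Tangent vectors and vector fields\<close>

text \<open>At every point one chart \<open>chart_at A p\<close> is selected, and the tangent space at \<open>p\<close> is the
  model space \<open>'e\<close>: an element of \<open>'e\<close> stands for the tangent vector at \<open>p\<close> which has it as its
  coordinate vector in the chart \<open>chart_at A p\<close>. So a vector field is a function \<open>'a \<Rightarrow> 'e\<close>, and a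
  section of the pull-back of the tangent bundle of \<open>'b\<close> along a map \<open>\<phi> :: 'a \<Rightarrow> 'b\<close> is a function
  \<open>'a \<Rightarrow> 'f\<close> whose value at \<open>p\<close> is a tangent vector at \<open>\<phi> p\<close>. Since \<open>chart_at A p\<close> varies with \<open>p\<close>
  in an uncontrolled way, fields must be converted to a fixed chart before they are
  differentiated.\<close>

definition chart_at :: "('a, 'e) chart set \<Rightarrow> 'a \<Rightarrow> ('a, 'e) chart" where
  "chart_at A p = (SOME c. c \<in> A \<and> p \<in> fst c)"

text \<open>Derivative at \<open>p\<close> of a vector-valued function on the manifold in the direction of the tangent
  vector \<open>u\<close>.\<close>

definition dir_deriv ::
    "('a, 'e::real_inner) chart set \<Rightarrow> 'a \<Rightarrow> ('a \<Rightarrow> 'f::real_normed_vector) \<Rightarrow> 'e \<Rightarrow> 'f" where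
  "dir_deriv A p F u =
     frechet_derivative (F \<circ> chart_inv (chart_at A p)) (at (snd (chart_at A p) p)) u"

definition tangent_map ::
    "('a, 'e::real_inner) chart set \<Rightarrow> ('b, 'f::real_inner) chart set \<Rightarrow> ('a \<Rightarrow> 'b) \<Rightarrow>
     'a \<Rightarrow> 'e \<Rightarrow> 'f" where
  "tangent_map A B \<phi> p u = dir_deriv A p (snd (chart_at B (\<phi> p)) \<circ> \<phi>) u"

text \<open>\<open>coord A c p u\<close> is the coordinate vector in an arbitrary chart \<open>c\<close> around \<open>p\<close> of the tangent
  vector \<open>u\<close> at \<open>p\<close>. Conversely, \<open>coord_field A c x\<close> is the vector field on the domain of \<open>c\<close> whose
  coordinate vector in \<open>c\<close> is constantly \<open>x\<close>.\<close>

definition coord :: "('a, 'e::real_inner) chart set \<Rightarrow> ('a, 'e) chart \<Rightarrow> 'a \<Rightarrow> 'e \<Rightarrow> 'e" where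
  "coord A c p u = dir_deriv A p (snd c) u"

definition coord_field :: "('a, 'e::real_inner) chart set \<Rightarrow> ('a, 'e) chart \<Rightarrow> 'e \<Rightarrow> 'a \<Rightarrow> 'e" where
  "coord_field A c x q = frechet_derivative (snd (chart_at A q) \<circ> chart_inv c) (at (snd c q)) x"

definition smooth_field_on ::
    "('a, 'e::real_inner) chart set \<Rightarrow> 'a set \<Rightarrow> ('a \<Rightarrow> 'e) \<Rightarrow> bool" where
  "smooth_field_on A W X \<longleftrightarrow>
     (\<forall>c\<in>A. smooth_on (snd c ` (fst c \<inter> W)) ((\<lambda>q. coord A c q (X q)) \<circ> chart_inv c))"

definition lie_bracket ::
    "('a, 'e::real_inner) chart set \<Rightarrow> ('a \<Rightarrow> 'e) \<Rightarrow> ('a \<Rightarrow> 'e) \<Rightarrow> 'a \<Rightarrow> 'e" where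
  "lie_bracket A X Y p =
     dir_deriv A p (\<lambda>q. coord A (chart_at A p) q (Y q)) (X p) -
     dir_deriv A p (\<lambda>q. coord A (chart_at A p) q (X q)) (Y p)"

section \<open>Riemannian metrics, the Levi-Civita connection and curvature\<close>

definition riemannian_metric ::
    "('a, 'e::real_inner) chart set \<Rightarrow> ('a \<Rightarrow> 'e \<Rightarrow> 'e \<Rightarrow> real) \<Rightarrow> bool" where
  "riemannian_metric A g \<longleftrightarrow>
     (\<forall>p u. linear (g p u)) \<and> (\<forall>p u v. g p u v = g p v u) \<and> (\<forall>p u. u \<noteq> 0 \<longrightarrow> g p u u > 0) \<and>
     (\<forall>c\<in>A. \<forall>x y. smooth_on (snd c ` fst c)
        ((\<lambda>q. g q (coord_field A c x q) (coord_field A c y q)) \<circ> chart_inv c))"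

text \<open>The Christoffel symbols of the second kind at \<open>p\<close> in the chart \<open>chart_at A p\<close>, as a bilinear
  map: \<open>christoffel A g p u v\<close> has the components \<open>\<Gamma>\<^sup>k\<^sub>i\<^sub>j u\<^sup>i v\<^sup>j\<close>, that is,
  \<open>2 g\<^sub>k\<^sub>l \<Gamma>\<^sup>k\<^sub>i\<^sub>j = \<partial>\<^sub>i g\<^sub>j\<^sub>l + \<partial>\<^sub>j g\<^sub>i\<^sub>l - \<partial>\<^sub>l g\<^sub>i\<^sub>j\<close>.\<close>

definition christoffel ::
    "('a, 'e::real_inner) chart set \<Rightarrow> ('a \<Rightarrow> 'e \<Rightarrow> 'e \<Rightarrow> real) \<Rightarrow> 'a \<Rightarrow> 'e \<Rightarrow> 'e \<Rightarrow> 'e" where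
  "christoffel A g p u v =
     (let D = coord_field A (chart_at A p) in
      THE w. \<forall>z. 2 * g p w z =
        dir_deriv A p (\<lambda>q. g q (D v q) (D z q)) u +
        dir_deriv A p (\<lambda>q. g q (D u q) (D z q)) v -
        dir_deriv A p (\<lambda>q. g q (D u q) (D v q)) z)"

text \<open>\<open>levi_civita A g X Y\<close> is the covariant derivative of the vector field \<open>Y\<close> in the direction of
  the vector field \<open>X\<close> for the Levi-Civita connection.\<close>

definition levi_civita ::
    "('a, 'e::real_inner) chart set \<Rightarrow> ('a \<Rightarrow> 'e \<Rightarrow> 'e \<Rightarrow> real) \<Rightarrow>
     ('a \<Rightarrow> 'e) \<Rightarrow> ('a \<Rightarrow> 'e) \<Rightarrow> 'a \<Rightarrow> 'e" where
  "levi_civita A g X Y p =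
     dir_deriv A p (\<lambda>q. coord A (chart_at A p) q (Y q)) (X p) + christoffel A g p (X p) (Y p)"

text \<open>Since the curvature is a tensor, its value at \<open>p\<close> on tangent vectors can be computed with any
  vector fields that extend them; the extensions with constant coefficients in the selected chart
  at \<open>p\<close> are used.\<close>

definition curvature ::
    "('a, 'e::real_inner) chart set \<Rightarrow> ('a \<Rightarrow> 'e \<Rightarrow> 'e \<Rightarrow> real) \<Rightarrow> 'a \<Rightarrow> 'e \<Rightarrow> 'e \<Rightarrow> 'e \<Rightarrow> 'e" where
  "curvature A g p u v w =
     (let X = coord_field A (chart_at A p) u;
          Y = coord_field A (chart_at A p) v;
          Z = coord_field A (chart_at A p) w
      in levi_civita A g X (levi_civita A g Y Z) p - levi_civita A g Y (levi_civita A g X Z) p -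
         levi_civita A g (lie_bracket A X Y) Z p)"

definition orthonormal_frame_near ::
    "('a::topological_space, 'e::real_inner) chart set \<Rightarrow> ('a \<Rightarrow> 'e \<Rightarrow> 'e \<Rightarrow> real) \<Rightarrow>
     'a \<Rightarrow> (nat \<Rightarrow> 'a \<Rightarrow> 'e) \<Rightarrow> bool" where
  "orthonormal_frame_near A g p E \<longleftrightarrow>
     (\<exists>W. open W \<and> p \<in> W \<and>
        (\<forall>i<dim (UNIV::'e set). smooth_field_on A W (E i)) \<and>
        (\<forall>q\<in>W. \<forall>i<dim (UNIV::'e set). \<forall>j<dim (UNIV::'e set).
           g q (E i q) (E j q) = (if i = j then 1 else 0)))"

section \<open>Harmonic and biharmonic maps\<close>

text \<open>The pull-back along \<open>\<phi>\<close> of the Levi-Civita connection of the target, applied to a section \<open>V\<close>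
  along \<open>\<phi>\<close> and a vector field \<open>X\<close> of the source.\<close>

definition pullback_conn ::
    "('a, 'e::real_inner) chart set \<Rightarrow> ('b, 'f::real_inner) chart set \<Rightarrow>
     ('b \<Rightarrow> 'f \<Rightarrow> 'f \<Rightarrow> real) \<Rightarrow> ('a \<Rightarrow> 'b) \<Rightarrow> ('a \<Rightarrow> 'e) \<Rightarrow> ('a \<Rightarrow> 'f) \<Rightarrow> 'a \<Rightarrow> 'f" where
  "pullback_conn A B h \<phi> X V p =
     dir_deriv A p (\<lambda>q. coord B (chart_at B (\<phi> p)) (\<phi> q) (V q)) (X p) +
     christoffel B h (\<phi> p) (tangent_map A B \<phi> p (X p)) (V p)"

text \<open>\<open>second_fund A g B h \<phi> X Y\<close> is \<open>(\<nabla>\<^sub>X d\<phi>)(Y)\<close>, and \<open>pullback_conn2 A g B h \<phi> X Y V\<close> is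
  \<open>(\<nabla>\<^sup>\<phi>)\<^sup>2\<^sub>X\<^sub>,\<^sub>Y V\<close>.\<close>

definition second_fund ::
    "('a, 'e::real_inner) chart set \<Rightarrow> ('a \<Rightarrow> 'e \<Rightarrow> 'e \<Rightarrow> real) \<Rightarrow>
     ('b, 'f::real_inner) chart set \<Rightarrow> ('b \<Rightarrow> 'f \<Rightarrow> 'f \<Rightarrow> real) \<Rightarrow> ('a \<Rightarrow> 'b) \<Rightarrow>
     ('a \<Rightarrow> 'e) \<Rightarrow> ('a \<Rightarrow> 'e) \<Rightarrow> 'a \<Rightarrow> 'f" where
  "second_fund A g B h \<phi> X Y p =
     pullback_conn A B h \<phi> X (\<lambda>q. tangent_map A B \<phi> q (Y q)) p -
     tangent_map A B \<phi> p (levi_civita A g X Y p)"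

definition pullback_conn2 ::
    "('a, 'e::real_inner) chart set \<Rightarrow> ('a \<Rightarrow> 'e \<Rightarrow> 'e \<Rightarrow> real) \<Rightarrow>
     ('b, 'f::real_inner) chart set \<Rightarrow> ('b \<Rightarrow> 'f \<Rightarrow> 'f \<Rightarrow> real) \<Rightarrow> ('a \<Rightarrow> 'b) \<Rightarrow>
     ('a \<Rightarrow> 'e) \<Rightarrow> ('a \<Rightarrow> 'e) \<Rightarrow> ('a \<Rightarrow> 'f) \<Rightarrow> 'a \<Rightarrow> 'f" where
  "pullback_conn2 A g B h \<phi> X Y V p =
     pullback_conn A B h \<phi> X (pullback_conn A B h \<phi> Y V) p -
     pullback_conn A B h \<phi> (levi_civita A g X Y) V p"

text \<open>For smooth \<open>\<phi>\<close> the following two sums do not depend on the orthonormal frame.\<close>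

definition tension ::
    "('a::topological_space, 'e::real_inner) chart set \<Rightarrow> ('a \<Rightarrow> 'e \<Rightarrow> 'e \<Rightarrow> real) \<Rightarrow>
     ('b, 'f::real_inner) chart set \<Rightarrow> ('b \<Rightarrow> 'f \<Rightarrow> 'f \<Rightarrow> real) \<Rightarrow> ('a \<Rightarrow> 'b) \<Rightarrow> 'a \<Rightarrow> 'f" where
  "tension A g B h \<phi> p =
     (let E = (SOME E. orthonormal_frame_near A g p E) in
      \<Sum>i<dim (UNIV::'e set). second_fund A g B h \<phi> (E i) (E i) p)"

definition bitension ::
    "('a::topological_space, 'e::real_inner) chart set \<Rightarrow> ('a \<Rightarrow> 'e \<Rightarrow> 'e \<Rightarrow> real) \<Rightarrow>
     ('b, 'f::real_inner) chart set \<Rightarrow> ('b \<Rightarrow> 'f \<Rightarrow> 'f \<Rightarrow> real) \<Rightarrow> ('a \<Rightarrow> 'b) \<Rightarrow> 'a \<Rightarrow> 'f" where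
  "bitension A g B h \<phi> p =
     (let E = (SOME E. orthonormal_frame_near A g p E); \<tau> = tension A g B h \<phi> in
      - (\<Sum>i<dim (UNIV::'e set).
           pullback_conn2 A g B h \<phi> (E i) (E i) \<tau> p +
           curvature B h (\<phi> p) (\<tau> p) (tangent_map A B \<phi> p (E i p)) (tangent_map A B \<phi> p (E i p))))"

definition harmonic ::
    "('a::topological_space, 'e::real_inner) chart set \<Rightarrow> ('a \<Rightarrow> 'e \<Rightarrow> 'e \<Rightarrow> real) \<Rightarrow>
     ('b, 'f::real_inner) chart set \<Rightarrow> ('b \<Rightarrow> 'f \<Rightarrow> 'f \<Rightarrow> real) \<Rightarrow> ('a \<Rightarrow> 'b) \<Rightarrow> bool" where
  "harmonic A g B h \<phi> \<longleftrightarrow> (\<forall>p. tension A g B h \<phi> p = 0)"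

definition biharmonic ::
    "('a::topological_space, 'e::real_inner) chart set \<Rightarrow> ('a \<Rightarrow> 'e \<Rightarrow> 'e \<Rightarrow> real) \<Rightarrow>
     ('b, 'f::real_inner) chart set \<Rightarrow> ('b \<Rightarrow> 'f \<Rightarrow> 'f \<Rightarrow> real) \<Rightarrow> ('a \<Rightarrow> 'b) \<Rightarrow> bool" where
  "biharmonic A g B h \<phi> \<longleftrightarrow> (\<forall>p. bitension A g B h \<phi> p = 0)"

definition submersion ::
    "('a, 'e::real_inner) chart set \<Rightarrow> ('b, 'f::real_inner) chart set \<Rightarrow> ('a \<Rightarrow> 'b) \<Rightarrow> bool" where
  "submersion A B \<phi> \<longleftrightarrow> (\<forall>p. surj (tangent_map A B \<phi> p))"

section \<open>Riemannian Lie groups\<close>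

definition lie_group ::
    "'a::{t2_space,second_countable_topology} monoid \<Rightarrow> ('a, 'e::real_inner) chart set \<Rightarrow> bool" where
  "lie_group G A \<longleftrightarrow>
     group G \<and> carrier G = UNIV \<and> smooth_atlas A \<and> connected (UNIV::'a set) \<and>
     smooth_map (product_atlas A A) A (\<lambda>(x, y). x \<otimes>\<^bsub>G\<^esub> y) \<and> smooth_map A A (\<lambda>x. inv\<^bsub>G\<^esub> x)"

definition left_invariant ::
    "'a monoid \<Rightarrow> ('a, 'e::real_inner) chart set \<Rightarrow> ('a \<Rightarrow> 'e \<Rightarrow> 'e \<Rightarrow> real) \<Rightarrow> bool" where
  "left_invariant G A g \<longleftrightarrow>
     (\<forall>x p u v. g (x \<otimes>\<^bsub>G\<^esub> p) (tangent_map A A (\<lambda>y. x \<otimes>\<^bsub>G\<^esub> y) p u) (tangent_map A A (\<lambda>y. x \<otimes>\<^bsub>G\<^esub> y) p v) =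
        g p u v)"

definition right_invariant ::
    "'a monoid \<Rightarrow> ('a, 'e::real_inner) chart set \<Rightarrow> ('a \<Rightarrow> 'e \<Rightarrow> 'e \<Rightarrow> real) \<Rightarrow> bool" where
  "right_invariant G A g \<longleftrightarrow>
     (\<forall>x p u v. g (p \<otimes>\<^bsub>G\<^esub> x) (tangent_map A A (\<lambda>y. y \<otimes>\<^bsub>G\<^esub> x) p u) (tangent_map A A (\<lambda>y. y \<otimes>\<^bsub>G\<^esub> x) p v) =
        g p u v)"

definition bi_invariant ::
    "'a monoid \<Rightarrow> ('a, 'e::real_inner) chart set \<Rightarrow> ('a \<Rightarrow> 'e \<Rightarrow> 'e \<Rightarrow> real) \<Rightarrow> bool" where
  "bi_invariant G A g \<longleftrightarrow> left_invariant G A g \<and> right_invariant G A g"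

definition riemannian_lie_group ::
    "'a::{t2_space,second_countable_topology} monoid \<Rightarrow> ('a, 'e::real_inner) chart set \<Rightarrow>
     ('a \<Rightarrow> 'e \<Rightarrow> 'e \<Rightarrow> real) \<Rightarrow> bool" where
  "riemannian_lie_group G A g \<longleftrightarrow> lie_group G A \<and> riemannian_metric A g \<and> left_invariant G A g"

definition lie_group_hom ::
    "'a::topological_space monoid \<Rightarrow> ('a, 'e::real_inner) chart set \<Rightarrow>
     'b::topological_space monoid \<Rightarrow> ('b, 'f::real_inner) chart set \<Rightarrow> ('a \<Rightarrow> 'b) \<Rightarrow> bool" where
  "lie_group_hom G A H B \<phi> \<longleftrightarrow> \<phi> \<in> hom G H \<and> smooth_map A B \<phi>"

text \<open>The Lie algebra is the tangent space \<open>'e\<close> at the identity, with the bracket of left invariant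
  vector fields.\<close>

definition left_inv_field ::
    "'a monoid \<Rightarrow> ('a, 'e::real_inner) chart set \<Rightarrow> 'e \<Rightarrow> 'a \<Rightarrow> 'e" where
  "left_inv_field G A u p = tangent_map A A (\<lambda>y. p \<otimes>\<^bsub>G\<^esub> y) \<one>\<^bsub>G\<^esub> u"

definition ad :: "'a monoid \<Rightarrow> ('a, 'e::real_inner) chart set \<Rightarrow> 'e \<Rightarrow> 'e \<Rightarrow> 'e" where
  "ad G A u v = lie_bracket A (left_inv_field G A u) (left_inv_field G A v) \<one>\<^bsub>G\<^esub>"

text \<open>The trace of an endomorphism of a finite-dimensional space, computed in any basis.\<close>

definition lin_trace :: "('e::real_vector \<Rightarrow> 'e) \<Rightarrow> real" where
  "lin_trace f =
     (let B = (SOME B. finite B \<and> independent B \<and> span B = UNIV) in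
      \<Sum>b\<in>B. representation B (f b) b)"

definition unimodular :: "'a monoid \<Rightarrow> ('a, 'e::real_inner) chart set \<Rightarrow> bool" where
  "unimodular G A \<longleftrightarrow> (\<forall>u. lin_trace (ad G A u) = 0)"

end

(*  In the left trivialisation of its tangent bundle, a section of the pull-back of TH along phi is a
    function w from G to the Lie algebra of H. There the pull-back connection becomes
    X |-> dw(X) + N(theta(X), w), where theta is d phi followed by the trivialisation and N is the
    bilinear map with nabla_u v = N(u, v) for left invariant fields, determined by the Koszul formula.
    With F the derivative of phi at 1, which is a homomorphism of Lie algebras, the tension field is
    left translation of the constant
      T = sum_i N(F e_i, F e_i) - F (sum_i N(e_i, e_i))
    for any orthonormal basis e_i of the Lie algebra of G.

    If a metric is bi-invariant, every ad_z is skew and N = [., .] / 2, so N(u, u) = 0. In (i) only the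
    first sum remains, and its product with F z is the trace of the product of the skew map ad_z and
    the symmetric map F^* F, hence 0. In (ii), T = - F U where U is dual to the form z |-> tr ad_z,
    which is 0 if the Lie algebra is unimodular. In the bitension field the iterated brackets of
    curvature and second covariant derivative cancel for each i, and the remaining sum is
    N(T, T) = 0.  *)

theory Submission
  imports Defs
begin

section \<open>Linear algebra of scalar products\<close>

text \<open>All constants for tangent vectors refer to the chart that \<open>chart_at\<close> picks
  at each point, so a field can be differentiated only after conversion to one fixed chart. Left
  coordinates turn a section into a function with values in one vector space. What is then
  differentiated has mostly the form \<open>M q (z q)\<close> with \<open>M q\<close> linear, and
  one product rule, \<open>has_derivative_apply_linear\<close>, serves metrics, frames and
  connections alike. The frames in \<open>tension\<close> and \<open>bitension\<close> come from
  \<open>SOME\<close>; they need not be left invariant and may change from point to point. Hence the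
  computations are done for an arbitrary frame: the derivative of its left coordinates enters both
  terms of a difference and drops out. \<open>curvature\<close> is defined with coordinate fields,
  whose left coordinates are not constant. Symmetry of second derivatives and the structure equation
  of the Maurer-Cartan form lead back to an algebraic expression in N. The same symmetry makes F
  compatible with brackets and relates left to right translations.\<close>

locale scalar_product =
  fixes \<beta> :: "'e::real_vector \<Rightarrow> 'e \<Rightarrow> real"
  assumes fin: "\<exists>B::'e set. finite B \<and> span B = UNIV"
    and linear_right: "linear (\<beta> u)"
    and commute: "\<beta> u v = \<beta> v u"
    and pos: "u \<noteq> 0 \<Longrightarrow> \<beta> u u > 0"
begin

text \<open>Indexed by an initial segment of the naturals, as in
  \<open>orthonormal_frame_near\<close>, so that the values of a frame at a point fit it directly
  and dimension 0 is included.\<close>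

definition orthonormal :: "(nat \<Rightarrow> 'e) \<Rightarrow> nat \<Rightarrow> bool" where
  "orthonormal e k \<longleftrightarrow> (\<forall>i<k. \<forall>j<k. \<beta> (e i) (e j) = (if i = j then 1 else 0))"

lemma linear_left: "linear (\<lambda>u. \<beta> u v)"
  using linear_right[of v] by (simp add: commute[of _ v])

lemmas right_simps = linear_add[OF linear_right] linear_cmul[OF linear_right]
  linear_sum[OF linear_right] linear_diff[OF linear_right] linear_0[OF linear_right]
  linear_neg[OF linear_right]

lemmas left_simps = linear_add[OF linear_left] linear_cmul[OF linear_left]
  linear_sum[OF linear_left] linear_diff[OF linear_left] linear_0[OF linear_left]
  linear_neg[OF linear_left]

text \<open>Testing with \<open>u - w\<close> itself contradicts positivity. Vectors of a Lie
  algebra are identified in this way whenever the Koszul formula or a trace determines them.\<close>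

lemma nondegenerate: "(\<And>v. \<beta> u v = \<beta> w v) \<Longrightarrow> u = w"
  using pos[of "u - w"] by (fastforce simp: left_simps)

lemma orthonormal_inner_sum:
  assumes "orthonormal e k" "j < k"
  shows "\<beta> (\<Sum>i<k. c i *\<^sub>R e i) (e j) = c j"
proof -
  have "\<beta> (\<Sum>i<k. c i *\<^sub>R e i) (e j) = (\<Sum>i<k. c i * \<beta> (e i) (e j))"
    by (simp add: left_simps)
  also have "\<dots> = (\<Sum>i<k. if i = j then c i else 0)"
  proof (rule sum.cong[OF refl])
    fix i assume "i \<in> {..<k}"
    then have "\<beta> (e i) (e j) = (if i = j then 1 else 0)"
      using assms unfolding orthonormal_def by blast
    then show "c i * \<beta> (e i) (e j) = (if i = j then c i else 0)" by simp
  qed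
  also have "\<dots> = c j" using assms(2) by simp
  finally show ?thesis .
qed

lemma finite_independent:
  fixes S :: "'e set"
  assumes "independent S"
  shows "finite S"
proof -
  obtain B :: "'e set" where "finite B" "span B = UNIV" using fin by auto
  then show ?thesis using independent_span_bound[of B S] assms by simp
qed

lemma orthonormal_independent:
  assumes "orthonormal e k"
  shows "inj_on e {..<k}" "independent (e ` {..<k})"
proof -
  show inj: "inj_on e {..<k}"
  proof (rule inj_onI)
    fix i j assume ij: "i \<in> {..<k}" "j \<in> {..<k}" and eq: "e i = e j"
    have "\<beta> (e i) (e j) = (if i = j then 1 else 0)" "\<beta> (e j) (e j) = 1"
      using assms ij unfolding orthonormal_def by auto
    then show "i = j" using eq by (simp split: if_splits)
  qed
  show "independent (e ` {..<k})"
  proof (rule independent_if_scalars_zero)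
    fix f x assume f: "(\<Sum>x\<in>e ` {..<k}. f x *\<^sub>R x) = 0" and x: "x \<in> e ` {..<k}"
    then obtain j where j: "j < k" "x = e j" by auto
    have "(\<Sum>i<k. f (e i) *\<^sub>R e i) = 0" using f by (simp add: sum.reindex[OF inj])
    then show "f x = 0"
      using orthonormal_inner_sum[OF assms j(1), of "\<lambda>i. f (e i)"] j by (simp add: left_simps)
  qed simp
qed

text \<open>A counting argument: an orthonormal family is independent, so it lies in a basis
  \<open>S\<close>; both have \<open>dim\<close> elements and therefore agree. Pairing the resulting
  expansion with \<open>e j\<close> identifies the coefficients.\<close>

lemma orthonormal_expand:
  assumes "orthonormal e (dim (UNIV::'e set))"
  shows "x = (\<Sum>i<dim (UNIV::'e set). \<beta> x (e i) *\<^sub>R e i)"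
proof -
  note ind = orthonormal_independent[OF assms]
  obtain S where S: "e ` {..<dim (UNIV::'e set)} \<subseteq> S" "independent S" "UNIV \<subseteq> span S"
    using maximal_independent_subset_extend[OF subset_UNIV ind(2)] by metis
  have "card S = dim (UNIV::'e set)" using S dim_eq_card[of S UNIV] by (metis span_UNIV top.extremum_uniqueI)
  moreover have "card (e ` {..<dim (UNIV::'e set)}) = dim (UNIV::'e set)" using ind(1) by (simp add: card_image)
  ultimately have "e ` {..<dim (UNIV::'e set)} = S"
    using card_subset_eq[OF finite_independent[OF S(2)] S(1)] by simp
  then have "x \<in> span (e ` {..<dim (UNIV::'e set)})" using S(3) by (metis UNIV_I subsetD)
  then have "x \<in> range (\<lambda>u. \<Sum>v\<in>e ` {..<dim (UNIV::'e set)}. u v *\<^sub>R v)"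
    by (simp only: span_finite finite_imageI finite_lessThan)
  then obtain u where "x = (\<Sum>v\<in>e ` {..<dim (UNIV::'e set)}. u v *\<^sub>R v)"
    by (rule imageE)
  then have x: "x = (\<Sum>i<dim (UNIV::'e set). u (e i) *\<^sub>R e i)" by (simp add: sum.reindex[OF ind(1)])
  have "\<beta> x (e j) = u (e j)" if "j < dim (UNIV::'e set)" for j
    by (subst x) (rule orthonormal_inner_sum[OF assms that])
  then have "(\<Sum>i<dim (UNIV::'e set). u (e i) *\<^sub>R e i) = (\<Sum>i<dim (UNIV::'e set). \<beta> x (e i) *\<^sub>R e i)"
    by (intro sum.cong) auto
  with x show ?thesis by (rule trans)
qed

text \<open>Gram-Schmidt, one vector per step. As long as fewer than \<open>dim\<close> vectors are
  present their span is proper, so some \<open>x\<close> lies outside it.\<close>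

lemma orthonormal_exists: obtains e where "orthonormal e (dim (UNIV::'e set))"
proof -
  have "\<exists>e. orthonormal e k" if "k \<le> dim (UNIV::'e set)" for k
    using that
  proof (induction k)
    case 0
    then show ?case by (simp add: orthonormal_def)
  next
    case (Suc k)
    then obtain e where e: "orthonormal e k" by auto
    have "span (e ` {..<k}) \<noteq> UNIV"
      using Suc.prems dim_eq_card[of "e ` {..<k}" UNIV] orthonormal_independent[OF e]
      by (auto simp: card_image)
    then obtain x where x: "x \<notin> span (e ` {..<k})" by auto
    define y where "y = x - (\<Sum>i<k. \<beta> x (e i) *\<^sub>R e i)"
    have "(\<Sum>i<k. \<beta> x (e i) *\<^sub>R e i) \<in> span (e ` {..<k})"
      by (intro span_sum span_scale span_base) auto
    moreover have "y = 0 \<Longrightarrow> x = (\<Sum>i<k. \<beta> x (e i) *\<^sub>R e i)" unfolding y_def by (rule iffD1[OF right_minus_eq])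
    ultimately have "y \<noteq> 0" using x by metis
    then have py: "\<beta> y y > 0" by (rule pos)
    have oy: "\<beta> y (e j) = 0" if "j < k" for j
    proof -
      have "\<beta> y (e j) = \<beta> x (e j) - \<beta> (\<Sum>i<k. \<beta> x (e i) *\<^sub>R e i) (e j)"
        unfolding y_def by (rule linear_diff[OF linear_left])
      also have "\<dots> = \<beta> x (e j) - \<beta> x (e j)"
        by (rule arg_cong[OF orthonormal_inner_sum[OF e that]])
      finally show ?thesis by simp
    qed
    define e' where "e' = e(k := (1 / sqrt (\<beta> y y)) *\<^sub>R y)"
    have "orthonormal e' (Suc k)"
      unfolding orthonormal_def
    proof (intro allI impI)
      fix i j assume "i < Suc k" "j < Suc k"
      then consider "i < k" "j < k" | "i = k" "j < k" | "i < k" "j = k" | "i = k" "j = k"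
        by linarith
      then show "\<beta> (e' i) (e' j) = (if i = j then 1 else 0)"
      proof cases
        case 1
        then have "e' i = e i" "e' j = e j" by (auto simp: e'_def)
        with 1 e show ?thesis unfolding orthonormal_def by metis
      next
        case 2
        then have "e' i = (1 / sqrt (\<beta> y y)) *\<^sub>R y" "e' j = e j" by (auto simp: e'_def)
        with 2 show ?thesis using oy[of j] by (simp only: left_simps) auto
      next
        case 3
        then have "e' j = (1 / sqrt (\<beta> y y)) *\<^sub>R y" "e' i = e i" by (auto simp: e'_def)
        with 3 show ?thesis using oy[of i] commute[of y "e i"] by (simp only: right_simps) auto
      next
        case 4
        then have "e' j = (1 / sqrt (\<beta> y y)) *\<^sub>R y" "e' i = (1 / sqrt (\<beta> y y)) *\<^sub>R y"
          by (auto simp: e'_def)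
        then have "\<beta> (e' i) (e' j) = 1 / sqrt (\<beta> y y) * (1 / sqrt (\<beta> y y) * \<beta> y y)"
          by (simp only: right_simps left_simps real_scaleR_def)
        also have "\<dots> = 1" using py by (simp add: field_simps)
        finally show ?thesis using 4 by simp
      qed
    qed
    then show ?case by blast
  qed
  then show ?thesis using that by blast
qed

text \<open>The representing vector has the coefficients \<open>l (e i)\<close>. Existence and
  uniqueness together give meaning to the definite description in
  \<open>christoffel\<close>.\<close>

lemma riesz:
  assumes "linear l"
  shows "\<exists>!w. \<forall>z. \<beta> w z = l z"
proof -
  obtain e where e: "orthonormal e (dim (UNIV::'e set))" using orthonormal_exists .
  have "\<beta> (\<Sum>i<dim (UNIV::'e set). l (e i) *\<^sub>R e i) z = l z" for z
  proof -
    have "l z = l (\<Sum>i<dim (UNIV::'e set). \<beta> z (e i) *\<^sub>R e i)" by (simp only: orthonormal_expand[OF e, symmetric])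
    also have "\<dots> = (\<Sum>i<dim (UNIV::'e set). \<beta> z (e i) * l (e i))"
      by (simp add: linear_sum[OF assms] linear_cmul[OF assms])
    finally show ?thesis by (simp add: left_simps commute[of z] mult.commute)
  qed
  then show ?thesis by (intro ex1I[of _ "\<Sum>i<dim (UNIV::'e set). l (e i) *\<^sub>R e i"] nondegenerate) auto
qed

text \<open>\<open>lin_trace\<close> refers to a basis fixed by \<open>SOME\<close>, while
  orthonormal bases arise from frames. Expanding \<open>e i\<close> in the former and
  \<open>f b\<close> in the latter produces one double sum, read in two orders.\<close>

lemma lin_trace_orthonormal:
  assumes e: "orthonormal e (dim (UNIV::'e set))" and f: "linear f"
  shows "lin_trace f = (\<Sum>i<dim (UNIV::'e set). \<beta> (f (e i)) (e i))"
proof -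
  define B where "B = (SOME B::'e set. finite B \<and> independent B \<and> span B = UNIV)"
  obtain B' :: "'e set" where "independent B'" "UNIV \<subseteq> span B'"
    using basis_exists[of UNIV] by metis
  then have "finite B' \<and> independent B' \<and> span B' = UNIV" using finite_independent by auto
  then have "finite B \<and> independent B \<and> span B = UNIV"
    unfolding B_def by (rule someI)
  then have B: "finite B" "independent B" "span B = UNIV" by auto
  let ?r = "\<lambda>x b. representation B x b"
  have r: "x = (\<Sum>b\<in>B. ?r x b *\<^sub>R b)" for x
    using sum_representation_eq[of B x B] B by simp
  have lr: "linear (\<lambda>x. ?r x b)" for b
    using B by (intro linearI) (simp_all add: representation_add representation_scale)
  have "(\<Sum>i<dim (UNIV::'e set). \<beta> (f (e i)) (e i)) = (\<Sum>i<dim (UNIV::'e set). \<beta> (f (\<Sum>b\<in>B. ?r (e i) b *\<^sub>R b)) (e i))"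
    by (simp only: r[symmetric])
  also have "\<dots> = (\<Sum>i<dim (UNIV::'e set). \<Sum>b\<in>B. ?r (e i) b * \<beta> (f b) (e i))"
    by (simp add: linear_sum[OF f] linear_cmul[OF f] left_simps)
  also have "\<dots> = (\<Sum>b\<in>B. \<Sum>i<dim (UNIV::'e set). ?r (e i) b * \<beta> (f b) (e i))"
    by (rule sum.swap)
  also have "\<dots> = (\<Sum>b\<in>B. ?r (\<Sum>i<dim (UNIV::'e set). \<beta> (f b) (e i) *\<^sub>R e i) b)"
    by (simp add: linear_sum[OF lr] linear_cmul[OF lr] mult.commute)
  also have "\<dots> = (\<Sum>b\<in>B. ?r (f b) b)"
    by (simp only: orthonormal_expand[OF e, symmetric])
  finally show ?thesis by (simp add: lin_trace_def B_def Let_def)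
qed

end

section \<open>Finite-dimensional calculus with the auxiliary inner product of a model space\<close>

definition onb :: "(nat \<Rightarrow> 'e::real_inner) \<Rightarrow> bool" where
  "onb e \<longleftrightarrow> (\<forall>x. x = (\<Sum>i<dim (UNIV::'e set). (x \<bullet> e i) *\<^sub>R e i))"

abbreviation finite_dim :: "'e::real_vector itself \<Rightarrow> bool" where
  "finite_dim T \<equiv> \<exists>B::'e set. finite B \<and> span B = UNIV"

lemma onb_exists:
  assumes "finite_dim TYPE('e::real_inner)"
  obtains e :: "nat \<Rightarrow> 'e::real_inner" where "onb e"
proof -
  interpret scalar_product "(\<bullet>) :: 'e \<Rightarrow> 'e \<Rightarrow> real"
    by unfold_locales (use assms in \<open>auto intro: inner_commute linearI simp: inner_simps\<close>)
  obtain e where "orthonormal e (dim (UNIV::'e set))" by (rule orthonormal_exists)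
  then have "onb e" unfolding onb_def by (intro allI orthonormal_expand)
  then show ?thesis by (rule that)
qed

lemma onb_linear:
  fixes e :: "nat \<Rightarrow> 'e::real_inner"
  assumes "onb e" "linear f"
  shows "f x = (\<Sum>i<dim (UNIV::'e set). (x \<bullet> e i) *\<^sub>R f (e i))"
proof -
  have "f x = f (\<Sum>i<dim (UNIV::'e set). (x \<bullet> e i) *\<^sub>R e i)"
    using assms(1) unfolding onb_def by (intro arg_cong[where f = f]) blast
  then show ?thesis by (simp only: linear_sum[OF assms(2)] linear_cmul[OF assms(2)])
qed

lemma linear_imp_bounded_linear:
  fixes f :: "'e::real_inner \<Rightarrow> 'f::real_normed_vector"
  assumes "finite_dim TYPE('e)" "linear f"
  shows "bounded_linear f"
proof -
  obtain e :: "nat \<Rightarrow> 'e" where e: "onb e" using onb_exists assms by blast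
  have "bounded_linear (\<lambda>x. \<Sum>i<dim (UNIV::'e set). (x \<bullet> e i) *\<^sub>R f (e i))"
    by (intro bounded_linear_sum bounded_linear_scaleR_const bounded_linear_inner_left)
  then show ?thesis by (simp add: onb_linear[OF e assms(2), symmetric])
qed

text \<open>\<open>M'\<close> is known only through the derivatives of \<open>M y v\<close> for
  separate vectors \<open>v\<close>; its linearity in \<open>v\<close> comes from uniqueness of
  derivatives, applied to sums and multiples.\<close>

lemma has_derivative_family_linear:
  fixes M :: "'x::real_normed_vector \<Rightarrow> 'e::real_vector \<Rightarrow> 'f::real_normed_vector"
  assumes S: "open S" "x \<in> S"
    and lin: "\<And>y. y \<in> S \<Longrightarrow> linear (M y)"
    and M: "\<And>v. ((\<lambda>y. M y v) has_derivative (\<lambda>u. M' u v)) (at x)"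
  shows "linear (M' u)"
proof (rule linearI)
  fix v w :: 'e and r :: real
  have "((\<lambda>y. M y v + M y w) has_derivative (\<lambda>u. M' u v + M' u w)) (at x)"
    by (intro has_derivative_add M)
  then have "((\<lambda>y. M y (v + w)) has_derivative (\<lambda>u. M' u v + M' u w)) (at x)"
    by (rule has_derivative_transform_within_open[OF _ S]) (simp add: linear_add[OF lin])
  from fun_cong[OF has_derivative_unique[OF M this], of u]
  show "M' u (v + w) = M' u v + M' u w" .
  have "((\<lambda>y. r *\<^sub>R M y v) has_derivative (\<lambda>u. r *\<^sub>R M' u v)) (at x)"
    by (intro has_derivative_scaleR_right M)
  then have "((\<lambda>y. M y (r *\<^sub>R v)) has_derivative (\<lambda>u. r *\<^sub>R M' u v)) (at x)"
    by (rule has_derivative_transform_within_open[OF _ S]) (simp add: linear_cmul[OF lin])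
  from fun_cong[OF has_derivative_unique[OF M this], of u]
  show "M' u (r *\<^sub>R v) = r *\<^sub>R M' u v" .
qed

text \<open>Product rule in which \<open>M\<close> is differentiated on constant vectors only.
  Expanding \<open>z y\<close> in a fixed basis turns \<open>M y (z y)\<close> into a finite sum of
  scalar functions times the differentiable functions \<open>M y (e i)\<close>.\<close>

lemma has_derivative_apply_linear:
  fixes M :: "'x::real_normed_vector \<Rightarrow> 'e::real_inner \<Rightarrow> 'f::real_normed_vector"
  assumes fd: "finite_dim TYPE('e)" and S: "open S" "x \<in> S"
    and lin: "\<And>y. y \<in> S \<Longrightarrow> linear (M y)"
    and M: "\<And>v. ((\<lambda>y. M y v) has_derivative (\<lambda>u. M' u v)) (at x)"
    and z: "(z has_derivative z') (at x)"
  shows "((\<lambda>y. M y (z y)) has_derivative (\<lambda>u. M' u (z x) + M x (z' u))) (at x)"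
proof -
  obtain e :: "nat \<Rightarrow> 'e" where e: "onb e" using onb_exists fd by blast
  let ?n = "dim (UNIV::'e set)"
  have d: "((\<lambda>y. \<Sum>i<?n. (z y \<bullet> e i) *\<^sub>R M y (e i)) has_derivative
      (\<lambda>u. \<Sum>i<?n. (z x \<bullet> e i) *\<^sub>R M' u (e i) + (z' u \<bullet> e i) *\<^sub>R M x (e i))) (at x)"
    by (intro has_derivative_sum has_derivative_scaleR M has_derivative_inner_left z)
  note M'lin = has_derivative_family_linear[OF S lin M]
  have "(\<Sum>i<?n. (z x \<bullet> e i) *\<^sub>R M' u (e i) + (z' u \<bullet> e i) *\<^sub>R M x (e i))
      = M' u (z x) + M x (z' u)" for u
    using onb_linear[OF e M'lin, of u "z x"] onb_linear[OF e lin[OF S(2)], of "z' u"]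
    by (simp add: sum.distrib)
  with d have "((\<lambda>y. \<Sum>i<?n. (z y \<bullet> e i) *\<^sub>R M y (e i)) has_derivative
      (\<lambda>u. M' u (z x) + M x (z' u))) (at x)" by simp
  then show ?thesis
    by (rule has_derivative_transform_within_open[OF _ S]) (rule onb_linear[OF e lin, symmetric])
qed

section \<open>Smooth functions\<close>

text \<open>\<open>C_k_on\<close> uses derivatives in the whole space, which at points of an open
  set see only the values on that set.\<close>

lemma C_k_on_cong:
  assumes "open S"
  shows "(\<And>x. x \<in> S \<Longrightarrow> f x = g x) \<Longrightarrow> C_k_on k S f \<Longrightarrow> C_k_on k S g"
proof (induction k arbitrary: f g)
  case 0
  then show ?case using continuous_on_cong[of S S f g] by simp
next
  case (Suc k)
  have d: "f differentiable (at x)" if "x \<in> S" for x using Suc.prems(2) that by simp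
  have "(g has_derivative frechet_derivative f (at x)) (at x)" if "x \<in> S" for x
    using has_derivative_transform_within_open[OF iffD1[OF frechet_derivative_works d[OF that]] assms that] Suc.prems(1)
    by blast
  then have gd: "g differentiable (at x)" "frechet_derivative g (at x) = frechet_derivative f (at x)"
    if "x \<in> S" for x
    using that by (auto simp: differentiable_def intro: frechet_derivative_at[symmetric])
  have "C_k_on k S (\<lambda>x. frechet_derivative g (at x) v)" for v
    by (rule Suc.IH[of "\<lambda>x. frechet_derivative f (at x) v"]) (use gd Suc.prems in auto)
  then show ?case using gd by simp
qed

lemma smooth_on_cong:
  "open S \<Longrightarrow> (\<And>x. x \<in> S \<Longrightarrow> f x = g x) \<Longrightarrow> smooth_on S f \<Longrightarrow> smooth_on S g"
  unfolding smooth_on_def using C_k_on_cong by blast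

lemma smooth_on_iff:
  "smooth_on S f \<longleftrightarrow> (\<forall>x\<in>S. f differentiable (at x)) \<and>
     (\<forall>v. smooth_on S (\<lambda>x. frechet_derivative f (at x) v))"
proof
  assume "smooth_on S f"
  then have "C_k_on (Suc k) S f" for k unfolding smooth_on_def by blast
  then show "(\<forall>x\<in>S. f differentiable (at x)) \<and> (\<forall>v. smooth_on S (\<lambda>x. frechet_derivative f (at x) v))"
    by (simp add: smooth_on_def)
next
  assume a: "(\<forall>x\<in>S. f differentiable (at x)) \<and> (\<forall>v. smooth_on S (\<lambda>x. frechet_derivative f (at x) v))"
  have "C_k_on k S f" for k
  proof (cases k)
    case 0
    then show ?thesis
      using a by (auto intro!: continuous_at_imp_continuous_on differentiable_imp_continuous_within)
  next
    case (Suc j)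
    then show ?thesis using a by (simp add: smooth_on_def)
  qed
  then show "smooth_on S f" by (simp add: smooth_on_def)
qed

lemma smooth_on_has_derivative:
  "smooth_on S f \<Longrightarrow> x \<in> S \<Longrightarrow> (f has_derivative frechet_derivative f (at x)) (at x)"
  using smooth_on_iff[of S f] frechet_derivative_works by blast

lemma smooth_on_frechet: "smooth_on S f \<Longrightarrow> smooth_on S (\<lambda>x. frechet_derivative f (at x) v)"
  using smooth_on_iff[of S f] by blast

text \<open>Differentiability gives continuity, the base of \<open>C_k_on\<close>, and closure under
  directional derivatives drives its recursion. Closure is asked only up to agreement on
  \<open>S\<close>, since nothing is known about derivatives off \<open>S\<close>.\<close>

lemma smooth_on_coinduct:
  assumes S: "open S" and f: "P f"
    and d: "\<And>f x. P f \<Longrightarrow> x \<in> S \<Longrightarrow> f differentiable (at x)"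
    and c: "\<And>f v. P f \<Longrightarrow> \<exists>g. P g \<and> (\<forall>x\<in>S. frechet_derivative f (at x) v = g x)"
  shows "smooth_on S f"
proof -
  have "C_k_on k S f" if "P f" for k f
    using that
  proof (induction k arbitrary: f)
    case 0
    then show ?case
      using d by (auto intro!: continuous_at_imp_continuous_on differentiable_imp_continuous_within)
  next
    case (Suc k)
    have "C_k_on k S (\<lambda>x. frechet_derivative f (at x) v)" for v
    proof -
      obtain g where g: "P g" "\<forall>x\<in>S. frechet_derivative f (at x) v = g x" using c[OF Suc.prems] by blast
      show ?thesis by (rule C_k_on_cong[OF S _ Suc.IH[OF g(1)]]) (use g(2) in simp)
    qed
    then show ?case using d[OF Suc.prems] by simp
  qed
  then show ?thesis using f by (simp add: smooth_on_def)
qed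

lemma smooth_on_const:
  assumes "open S"
  shows "smooth_on S (\<lambda>x. c)"
  by (rule smooth_on_coinduct[where P = "\<lambda>f. \<exists>c. f = (\<lambda>x. c)", OF assms]) auto

lemma C_k_on_add:
  assumes S: "open S"
  shows "C_k_on k S f \<Longrightarrow> C_k_on k S g \<Longrightarrow> C_k_on k S (\<lambda>x. f x + g x)"
proof (induction k arbitrary: f g)
  case 0
  then show ?case by (simp add: continuous_on_add)
next
  case (Suc k)
  then have D: "((\<lambda>x. f x + g x) has_derivative
      (\<lambda>v. frechet_derivative f (at x) v + frechet_derivative g (at x) v)) (at x)" if "x \<in> S" for x
    using that by (auto intro!: has_derivative_add simp: frechet_derivative_works[symmetric])
  have "C_k_on k S (\<lambda>x. frechet_derivative (\<lambda>x. f x + g x) (at x) v)" for v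
  proof (rule C_k_on_cong[OF S])
    show "C_k_on k S (\<lambda>x. frechet_derivative f (at x) v + frechet_derivative g (at x) v)"
      using Suc by simp
    show "frechet_derivative f (at x) v + frechet_derivative g (at x) v =
        frechet_derivative (\<lambda>x. f x + g x) (at x) v" if "x \<in> S" for x
      by (rule fun_cong[OF frechet_derivative_at[OF D[OF that]]])
  qed
  then show ?case using D by (auto simp: differentiable_def)
qed

lemma smooth_on_add:
  "open S \<Longrightarrow> smooth_on S f \<Longrightarrow> smooth_on S g \<Longrightarrow> smooth_on S (\<lambda>x. f x + g x)"
  by (simp add: smooth_on_def C_k_on_add)

lemma smooth_on_sum:
  assumes "open S" "\<And>i. i \<in> I \<Longrightarrow> smooth_on S (f i)"
  shows "smooth_on S (\<lambda>x. \<Sum>i\<in>I. f i x)"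
  using assms(2)
  by (induction I rule: infinite_finite_induct)
     (auto intro: smooth_on_const smooth_on_add assms(1))

text \<open>The induction on \<open>k\<close> keeps both factors smooth: in the product rule they
  reappear undifferentiated next to their derivatives, and all of these stay within the induction
  hypothesis.\<close>

lemma smooth_on_scaleR:
  assumes S: "open S" and f: "smooth_on S f" and g: "smooth_on S g"
  shows "smooth_on S (\<lambda>x. f x *\<^sub>R g x)"
proof -
  have "C_k_on k S (\<lambda>x. f x *\<^sub>R g x)" if "smooth_on S f" "smooth_on S g" for k f g
    using that
  proof (induction k arbitrary: f g)
    case 0
    then have "C_k_on 0 S f" "C_k_on 0 S g" unfolding smooth_on_def by blast+
    then show ?case by (simp add: continuous_on_scaleR)
  next
    case (Suc k)
    note d = smooth_on_has_derivative[OF Suc.prems(1)] smooth_on_has_derivative[OF Suc.prems(2)]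
    have D: "((\<lambda>x. f x *\<^sub>R g x) has_derivative
        (\<lambda>v. f x *\<^sub>R frechet_derivative g (at x) v + frechet_derivative f (at x) v *\<^sub>R g x)) (at x)"
      if "x \<in> S" for x
      by (intro has_derivative_scaleR d that)
    have "C_k_on k S (\<lambda>x. frechet_derivative (\<lambda>x. f x *\<^sub>R g x) (at x) v)" for v
    proof (rule C_k_on_cong[OF S])
      show "C_k_on k S (\<lambda>x. f x *\<^sub>R frechet_derivative g (at x) v + frechet_derivative f (at x) v *\<^sub>R g x)"
        by (intro C_k_on_add S Suc.IH smooth_on_frechet Suc.prems)
      show "f x *\<^sub>R frechet_derivative g (at x) v + frechet_derivative f (at x) v *\<^sub>R g x =
          frechet_derivative (\<lambda>x. f x *\<^sub>R g x) (at x) v" if "x \<in> S" for x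
        by (rule fun_cong[OF frechet_derivative_at[OF D[OF that]]])
    qed
    then show ?case using D by (auto simp: differentiable_def)
  qed
  with f g show ?thesis unfolding smooth_on_def[of S "\<lambda>x. f x *\<^sub>R g x"] by blast
qed

lemma smooth_on_bounded_linear:
  assumes S: "open S" and L: "bounded_linear L" and f: "smooth_on S f"
  shows "smooth_on S (\<lambda>x. L (f x))"
proof (rule smooth_on_coinduct[where P = "\<lambda>h. \<exists>f. smooth_on S f \<and> h = (\<lambda>x. L (f x))", OF S])
  show "\<exists>f'. smooth_on S f' \<and> (\<lambda>x. L (f x)) = (\<lambda>x. L (f' x))" using f by blast
next
  fix h x assume "\<exists>f. smooth_on S f \<and> h = (\<lambda>x. L (f x))" "x \<in> S"
  then show "h differentiable (at x)"
    using bounded_linear.has_derivative[OF L smooth_on_has_derivative] by (auto simp: differentiable_def)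
next
  fix h v assume "\<exists>f. smooth_on S f \<and> h = (\<lambda>x. L (f x))"
  then obtain f where h: "smooth_on S f" "h = (\<lambda>x. L (f x))" by blast
  have "frechet_derivative h (at x) v = L (frechet_derivative f (at x) v)" if "x \<in> S" for x
    unfolding h(2)
    by (rule fun_cong[OF frechet_derivative_at[symmetric]])
       (rule bounded_linear.has_derivative[OF L smooth_on_has_derivative[OF h(1) that]])
  then show "\<exists>k. (\<exists>f. smooth_on S f \<and> k = (\<lambda>x. L (f x))) \<and> (\<forall>x\<in>S. frechet_derivative h (at x) v = k x)"
    using smooth_on_frechet[OF h(1), of v] by blast
qed

text \<open>Composition with an affine map is the form in which group multiplication is restricted
  to slices with one argument fixed. The derivative in direction \<open>v\<close> is that of
  \<open>f\<close> in the constant direction \<open>i v\<close>, along the same affine map, so the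
  class is closed under differentiation.\<close>

lemma smooth_on_affine:
  fixes f :: "'c::real_normed_vector \<Rightarrow> 'd::real_normed_vector" and i :: "'b::real_normed_vector \<Rightarrow> 'c"
  assumes T: "open T" and i: "bounded_linear i" and f: "smooth_on S f" and sub: "\<And>x. x \<in> T \<Longrightarrow> a + i x \<in> S"
  shows "smooth_on T (\<lambda>x. f (a + i x))"
proof (rule smooth_on_coinduct[where P = "\<lambda>h. \<exists>f. smooth_on S f \<and> h = (\<lambda>x. f (a + i x))", OF T])
  show "\<exists>f'. smooth_on S f' \<and> (\<lambda>x. f (a + i x)) = (\<lambda>x. f' (a + i x))" using f by blast
  have D: "((\<lambda>x. f (a + i x)) has_derivative (\<lambda>v. frechet_derivative f (at (a + i x)) (i v))) (at x)"
    if "x \<in> T" "smooth_on S f" for x and f :: "'c \<Rightarrow> 'd"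
  proof -
    have "((\<lambda>x. a + i x) has_derivative i) (at x)"
      using has_derivative_add[OF has_derivative_const bounded_linear_imp_has_derivative[OF i]] by simp
    from has_derivative_compose[OF this smooth_on_has_derivative[OF that(2) sub[OF that(1)]]]
    show ?thesis .
  qed
  { fix h :: "'b \<Rightarrow> 'd" and x assume "\<exists>f. smooth_on S f \<and> h = (\<lambda>x. f (a + i x))" "x \<in> T"
    then show "h differentiable (at x)" using D by (auto simp: differentiable_def) }
  fix h :: "'b \<Rightarrow> 'd" and v assume "\<exists>f. smooth_on S f \<and> h = (\<lambda>x. f (a + i x))"
  then obtain f where h: "smooth_on S f" "h = (\<lambda>x. f (a + i x))" by blast
  have "frechet_derivative h (at x) v = (\<lambda>z. frechet_derivative f (at z) (i v)) (a + i x)" if "x \<in> T" for x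
    unfolding h(2) using fun_cong[OF frechet_derivative_at[OF D[OF that h(1)]]] by simp
  then show "\<exists>k. (\<exists>f. smooth_on S f \<and> k = (\<lambda>x. f (a + i x))) \<and> (\<forall>x\<in>T. frechet_derivative h (at x) v = k x)"
    using smooth_on_frechet[OF h(1), of "i v"] by blast
qed

section \<open>Symmetry of second derivatives\<close>

lemma second_difference:
  fixes f :: "'e::real_normed_vector \<Rightarrow> real"
  assumes S: "smooth_on S f" and e: "e > 0"
    and sub: "\<And>s t. 0 \<le> s \<Longrightarrow> s \<le> e \<Longrightarrow> 0 \<le> t \<Longrightarrow> t \<le> e \<Longrightarrow> z + s *\<^sub>R a + t *\<^sub>R b \<in> S"
  shows "\<exists>s t. 0 \<le> s \<and> s \<le> e \<and> 0 \<le> t \<and> t \<le> e \<and>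
    f (z + e *\<^sub>R a + e *\<^sub>R b) - f (z + e *\<^sub>R a) - f (z + e *\<^sub>R b) + f z =
    e * e * frechet_derivative (\<lambda>x. frechet_derivative f (at x) a) (at (z + s *\<^sub>R a + t *\<^sub>R b)) b"
proof -
  have line: "((\<lambda>s. k (p + s *\<^sub>R d)) has_real_derivative frechet_derivative k (at (p + s *\<^sub>R d)) d) (at s)"
    if k: "smooth_on S k" "p + s *\<^sub>R d \<in> S" for k :: "'e \<Rightarrow> real" and p d s
  proof -
    have "((\<lambda>s. p + s *\<^sub>R d) has_derivative (\<lambda>h. h *\<^sub>R d)) (at s)"
      by (auto intro!: derivative_eq_intros)
    note D = smooth_on_has_derivative[OF k]
    from has_derivative_compose[OF \<open>((\<lambda>s. p + s *\<^sub>R d) has_derivative _) _\<close> D]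
    have "((\<lambda>s. k (p + s *\<^sub>R d)) has_derivative (\<lambda>h. frechet_derivative k (at (p + s *\<^sub>R d)) (h *\<^sub>R d))) (at s)" .
    moreover have "frechet_derivative k (at (p + s *\<^sub>R d)) (h *\<^sub>R d) = frechet_derivative k (at (p + s *\<^sub>R d)) d * h" for h
      using linear_cmul[OF has_derivative_linear[OF D]] by (simp add: mult.commute)
    ultimately show ?thesis by (simp add: has_field_derivative_def)
  qed
  \<comment> \<open>The mean value theorem is used twice on a parallelogram: along \<open>a\<close>
    for the difference in direction \<open>b\<close>, then along \<open>b\<close> for the derivative
    in direction \<open>a\<close>.\<close>
  let ?h = "\<lambda>s. f (z + e *\<^sub>R b + s *\<^sub>R a) - f (z + s *\<^sub>R a)"
  have "DERIV ?h s :> frechet_derivative f (at (z + e *\<^sub>R b + s *\<^sub>R a)) a - frechet_derivative f (at (z + s *\<^sub>R a)) a"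
    if "0 \<le> s" "s \<le> e" for s
    using sub[OF that, of e] sub[OF that, of 0] e
    by (intro DERIV_diff line S) (simp_all add: add_ac)
  from MVT2[OF e this] obtain s where s: "0 < s" "s < e" and
    h: "?h e - ?h 0 = e * (frechet_derivative f (at (z + e *\<^sub>R b + s *\<^sub>R a)) a - frechet_derivative f (at (z + s *\<^sub>R a)) a)"
    by auto
  let ?k = "\<lambda>x. frechet_derivative f (at x) a"
  have "DERIV (\<lambda>t. ?k (z + s *\<^sub>R a + t *\<^sub>R b)) t :> frechet_derivative ?k (at (z + s *\<^sub>R a + t *\<^sub>R b)) b"
    if "0 \<le> t" "t \<le> e" for t
    using sub[of s t] s that by (intro line smooth_on_frechet S) simp_all
  from MVT2[OF e this] obtain t where t: "0 < t" "t < e" and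
    k: "?k (z + s *\<^sub>R a + e *\<^sub>R b) - ?k (z + s *\<^sub>R a) = e * frechet_derivative ?k (at (z + s *\<^sub>R a + t *\<^sub>R b)) b"
    by auto
  have "f (z + e *\<^sub>R a + e *\<^sub>R b) - f (z + e *\<^sub>R a) - f (z + e *\<^sub>R b) + f z = ?h e - ?h 0"
    by (simp add: add_ac)
  also have "\<dots> = e * e * frechet_derivative ?k (at (z + s *\<^sub>R a + t *\<^sub>R b)) b"
    unfolding h using k by (simp add: add_ac)
  finally show ?thesis using s t by (intro exI[of _ s] exI[of _ t]) simp
qed

text \<open>The second difference of \<open>f\<close> over a parallelogram is symmetric in
  \<open>a\<close> and \<open>b\<close>, and up to the factor \<open>e * e\<close> it is a value of
  either mixed derivative at a nearby point. If the two differed at \<open>z\<close>, continuity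
  would keep them apart near \<open>z\<close>.\<close>

lemma second_derivative_symmetric_real:
  fixes f :: "'e::real_normed_vector \<Rightarrow> real"
  assumes "open S" "z \<in> S" and f: "smooth_on S f"
  shows "frechet_derivative (\<lambda>x. frechet_derivative f (at x) a) (at z) b =
    frechet_derivative (\<lambda>x. frechet_derivative f (at x) b) (at z) a"
proof (rule ccontr)
  let ?H = "\<lambda>a b x. frechet_derivative (\<lambda>x. frechet_derivative f (at x) a) (at x) b"
  assume ne: "?H a b z \<noteq> ?H b a z"
  define d where "d = \<bar>?H a b z - ?H b a z\<bar> / 2"
  have d: "d > 0" using ne by (simp add: d_def)
  have c: "continuous (at z) (?H a b)" for a b
    using smooth_on_has_derivative[OF smooth_on_frechet[OF smooth_on_frechet[OF f]] assms(2)]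
    by (rule has_derivative_continuous)
  obtain r where r: "r > 0" "\<And>x. dist x z < r \<Longrightarrow> dist (?H a b x) (?H a b z) < d"
      "\<And>x. dist x z < r \<Longrightarrow> dist (?H b a x) (?H b a z) < d" "ball z r \<subseteq> S"
  proof -
    obtain r1 where "r1 > 0" "\<And>x. dist x z < r1 \<Longrightarrow> dist (?H a b x) (?H a b z) < d"
      using c[of a b] d by (auto simp: continuous_at_eps_delta)
    moreover obtain r2 where "r2 > 0" "\<And>x. dist x z < r2 \<Longrightarrow> dist (?H b a x) (?H b a z) < d"
      using c[of b a] d by (auto simp: continuous_at_eps_delta)
    moreover obtain r3 where "r3 > 0" "ball z r3 \<subseteq> S"
      using assms(1,2) by (meson open_contains_ball)
    ultimately show ?thesis by (intro that[of "min r1 (min r2 r3)"]) auto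
  qed
  \<comment> \<open>The added 1 keeps the denominator positive when \<open>a\<close> and
    \<open>b\<close> both vanish; the factor 2 leaves the parallelogram within \<open>r / 2\<close>
    of \<open>z\<close>.\<close>
  define e where "e = r / (2 * (norm a + norm b + 1))"
  have pos: "norm a + norm b + 1 > 0" using norm_ge_zero[of a] norm_ge_zero[of b] by linarith
  then have e: "e > 0" using r(1) by (simp add: e_def)
  have ee: "e * (norm a + norm b + 1) = r / 2"
  proof -
    have "r / (2 * P) * P = r / 2" if "P > 0" for P :: real using that by simp
    from this[OF pos] show ?thesis by (simp only: e_def)
  qed
  have near: "dist (z + s *\<^sub>R a + t *\<^sub>R b) z < r" if "0 \<le> s" "s \<le> e" "0 \<le> t" "t \<le> e" for s t
  proof -
    have "dist (z + s *\<^sub>R a + t *\<^sub>R b) z = norm (s *\<^sub>R a + t *\<^sub>R b)" by (simp add: dist_norm)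
    also have "\<dots> \<le> s * norm a + t * norm b"
      using norm_triangle_ineq[of "s *\<^sub>R a" "t *\<^sub>R b"] that by simp
    also have "\<dots> \<le> e * norm a + e * norm b" using that by (intro add_mono mult_right_mono) auto
    also have "\<dots> \<le> r / 2" using ee e by (simp add: algebra_simps)
    finally show ?thesis using r(1) by simp
  qed
  have inS: "z + s *\<^sub>R a + t *\<^sub>R b \<in> S" if "0 \<le> s" "s \<le> e" "0 \<le> t" "t \<le> e" for s t
    using near[OF that] r(4) by (auto simp: dist_commute)
  obtain s t where st: "0 \<le> s" "s \<le> e" "0 \<le> t" "t \<le> e"
    "f (z + e *\<^sub>R a + e *\<^sub>R b) - f (z + e *\<^sub>R a) - f (z + e *\<^sub>R b) + f z = e * e * ?H a b (z + s *\<^sub>R a + t *\<^sub>R b)"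
    using second_difference[OF f e, of z a b] inS by blast
  have inS': "z + s *\<^sub>R b + t *\<^sub>R a \<in> S" if "0 \<le> s" "s \<le> e" "0 \<le> t" "t \<le> e" for s t
    using inS[of t s] that by (simp add: add_ac)
  obtain s' t' where st': "0 \<le> s'" "s' \<le> e" "0 \<le> t'" "t' \<le> e"
    "f (z + e *\<^sub>R b + e *\<^sub>R a) - f (z + e *\<^sub>R b) - f (z + e *\<^sub>R a) + f z = e * e * ?H b a (z + s' *\<^sub>R b + t' *\<^sub>R a)"
    using second_difference[OF f e, of z b a] inS' by blast
  have comm: "z + e *\<^sub>R b + e *\<^sub>R a = z + e *\<^sub>R a + e *\<^sub>R b" by (simp add: add_ac)
  have "e * e * ?H a b (z + s *\<^sub>R a + t *\<^sub>R b) = e * e * ?H b a (z + s' *\<^sub>R b + t' *\<^sub>R a)"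
    using st(5) st'(5) unfolding comm by linarith
  then have eq: "?H a b (z + s *\<^sub>R a + t *\<^sub>R b) = ?H b a (z + s' *\<^sub>R b + t' *\<^sub>R a)" using e by simp
  have comm': "z + s' *\<^sub>R b + t' *\<^sub>R a = z + t' *\<^sub>R a + s' *\<^sub>R b" by (simp add: add_ac)
  have "dist (?H a b (z + s *\<^sub>R a + t *\<^sub>R b)) (?H a b z) < d" by (intro r near st)
  moreover have "dist (?H a b (z + s *\<^sub>R a + t *\<^sub>R b)) (?H b a z) < d"
    unfolding eq unfolding comm' by (intro r near st')
  ultimately have "dist (?H a b z) (?H b a z) < d + d"
    by (meson add_strict_mono dist_triangle3 le_less_trans)
  then show False by (simp add: d_def dist_real_def)
qed

text \<open>Reduction to real functions by pairing with an arbitrary \<open>w\<close>, which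
  determines a vector of an inner product space.\<close>

lemma second_derivative_symmetric:
  fixes f :: "'e::real_normed_vector \<Rightarrow> 'f::real_inner"
  assumes S: "open S" "z \<in> S" and f: "smooth_on S f"
  shows "frechet_derivative (\<lambda>x. frechet_derivative f (at x) a) (at z) b =
    frechet_derivative (\<lambda>x. frechet_derivative f (at x) b) (at z) a"
proof -
  have inner: "frechet_derivative (\<lambda>x. k x \<bullet> w) (at x) v = frechet_derivative k (at x) v \<bullet> w"
    if "smooth_on S k" "x \<in> S" for k :: "'e \<Rightarrow> 'f" and x v w
    by (rule fun_cong[OF frechet_derivative_at[symmetric]])
       (rule has_derivative_inner_left[OF smooth_on_has_derivative[OF that]])
  have second: "frechet_derivative (\<lambda>x. frechet_derivative f (at x) a) (at z) b \<bullet> w =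
      frechet_derivative (\<lambda>x. frechet_derivative (\<lambda>x. f x \<bullet> w) (at x) a) (at z) b" for a b w
  proof -
    have "frechet_derivative (\<lambda>x. frechet_derivative f (at x) a) (at z) b \<bullet> w =
        frechet_derivative (\<lambda>x. frechet_derivative f (at x) a \<bullet> w) (at z) b"
      by (rule inner[OF smooth_on_frechet[OF f] S(2), symmetric])
    also have "\<dots> = frechet_derivative (\<lambda>x. frechet_derivative (\<lambda>x. f x \<bullet> w) (at x) a) (at z) b"
      using has_derivative_inner_left[OF smooth_on_has_derivative[OF smooth_on_frechet[OF f] S(2)]]
      by (intro fun_cong[OF frechet_derivative_transform_within_open[OF _ S]])
         (auto simp: inner[OF f] differentiable_def)
    finally show ?thesis .
  qed
  have sm: "smooth_on S (\<lambda>x. f x \<bullet> w)" for w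
    by (rule smooth_on_bounded_linear[OF S(1) bounded_linear_inner_left f])
  have "frechet_derivative (\<lambda>x. frechet_derivative f (at x) a) (at z) b \<bullet> w =
      frechet_derivative (\<lambda>x. frechet_derivative f (at x) b) (at z) a \<bullet> w" for w
    unfolding second by (rule second_derivative_symmetric_real[OF S sm])
  then show ?thesis by (metis vector_eq_rdot)
qed

section \<open>Derivatives on manifolds\<close>

text \<open>The relational form of the chart-wise derivative in \<^const>\<open>dir_deriv\<close>; it records
  differentiability as well, and all constants for tangent vectors are instances.\<close>

definition chart_deriv ::
    "('a, 'e::real_inner) chart \<Rightarrow> ('a \<Rightarrow> 'v::real_normed_vector) \<Rightarrow> 'a \<Rightarrow> ('e \<Rightarrow> 'v) \<Rightarrow> bool" where
  "chart_deriv c F p F' \<longleftrightarrow> ((F \<circ> chart_inv c) has_derivative F') (at (snd c p))"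

lemma chart_inv_eq: "is_chart c \<Longrightarrow> q \<in> fst c \<Longrightarrow> chart_inv c (snd c q) = q"
  by (simp add: is_chart_def homeomorphism_def)

lemma chart_inv_in: "x \<in> snd c ` fst c \<Longrightarrow> chart_inv c x \<in> fst c"
  by (rule inv_into_into)

lemma chart_chart_inv: "x \<in> snd c ` fst c \<Longrightarrow> snd c (chart_inv c x) = x"
  by (rule f_inv_into_f)

text \<open>The image is the preimage of \<open>W\<close> under the continuous chart inverse, within
  the open set of all coordinates.\<close>

lemma open_chart_image:
  assumes "is_chart c" "open W"
  shows "open (snd c ` (fst c \<inter> W))"
proof -
  have "snd c ` (fst c \<inter> W) = snd c ` fst c \<inter> chart_inv c -` W"
  proof (intro subset_antisym subsetI)
    fix x assume "x \<in> snd c ` (fst c \<inter> W)"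
    then show "x \<in> snd c ` fst c \<inter> chart_inv c -` W" using chart_inv_eq[OF assms(1)] by auto
  next
    fix x assume "x \<in> snd c ` fst c \<inter> chart_inv c -` W"
    then show "x \<in> snd c ` (fst c \<inter> W)"
      using chart_chart_inv[of x c] chart_inv_in[of x c] by (intro image_eqI[of _ _ "chart_inv c x"]) auto
  qed
  moreover have "open (snd c ` fst c \<inter> chart_inv c -` W)"
    using assms by (intro continuous_open_preimage) (auto simp: is_chart_def homeomorphism_def)
  ultimately show ?thesis by simp
qed

lemma chart_deriv_cong:
  assumes c: "is_chart c" "p \<in> fst c" and W: "open W" "p \<in> W"
    and eq: "\<And>q. q \<in> fst c \<Longrightarrow> q \<in> W \<Longrightarrow> F q = F2 q"
    and F: "chart_deriv c F p F'"
  shows "chart_deriv c F2 p F'"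
  using F unfolding chart_deriv_def
  by (rule has_derivative_transform_within_open[OF _ open_chart_image[OF c(1) W(1)]])
     (use c W eq in \<open>auto simp: chart_inv_eq\<close>)

lemma chart_deriv_unique: "chart_deriv c F p F1 \<Longrightarrow> chart_deriv c F p F2 \<Longrightarrow> F1 = F2"
  unfolding chart_deriv_def by (rule has_derivative_unique)

lemma chart_deriv_linear: "chart_deriv c F p F' \<Longrightarrow> linear F'"
  unfolding chart_deriv_def by (rule has_derivative_linear)

lemma chart_deriv_dir_deriv: "chart_deriv (chart_at A p) F p F' \<Longrightarrow> dir_deriv A p F u = F' u"
  unfolding chart_deriv_def dir_deriv_def by (drule frechet_derivative_at) simp

lemma chart_deriv_const: "chart_deriv c (\<lambda>q. k) p (\<lambda>u. 0)"
  by (simp add: chart_deriv_def o_def)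

lemma chart_deriv_self:
  assumes "is_chart c" "p \<in> fst c"
  shows "chart_deriv c (snd c) p (\<lambda>u. u)"
  unfolding chart_deriv_def
  by (rule has_derivative_transform_within_open[OF has_derivative_ident
        open_chart_image[OF assms(1) open_UNIV]]) (use assms in \<open>auto simp: chart_chart_inv\<close>)

text \<open>For \<open>chart_inv d\<close> to cancel \<open>snd d\<close>, the values of \<phi> must
  stay inside the domain of \<open>d\<close>; continuity of \<phi> provides a neighbourhood on which
  they do.\<close>

lemma chart_deriv_chain:
  assumes c: "is_chart c" "p \<in> fst c" and d: "is_chart d" "\<phi> p \<in> fst d"
    and cont: "continuous_on UNIV \<phi>"
    and \<phi>: "chart_deriv c (snd d \<circ> \<phi>) p L" and F: "chart_deriv d F (\<phi> p) F'"
  shows "chart_deriv c (F \<circ> \<phi>) p (\<lambda>u. F' (L u))"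
proof -
  have "open (\<phi> -` fst d)" using cont d(1) by (auto simp: is_chart_def intro: open_vimage)
  from open_chart_image[OF c(1) this] have op: "open (snd c ` (fst c \<inter> \<phi> -` fst d))" .
  have "((F \<circ> chart_inv d) has_derivative F') (at ((snd d \<circ> \<phi> \<circ> chart_inv c) (snd c p)))"
    using F by (simp add: chart_deriv_def chart_inv_eq[OF c])
  from has_derivative_compose[OF \<phi>[unfolded chart_deriv_def] this]
  show ?thesis unfolding chart_deriv_def
    by (rule has_derivative_transform_within_open[OF _ op])
       (use c d in \<open>auto simp: chart_inv_eq\<close>)
qed

lemma chart_deriv_compose:
  assumes "chart_deriv c F p F'" "(k has_derivative k') (at (F p))" "is_chart c" "p \<in> fst c"
  shows "chart_deriv c (\<lambda>q. k (F q)) p (\<lambda>u. k' (F' u))"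
  using has_derivative_compose[OF assms(1)[unfolded chart_deriv_def], of k k'] assms(2)
  by (simp add: chart_deriv_def o_def chart_inv_eq[OF assms(3,4)])

lemma chart_deriv_smooth:
  assumes "smooth_on (snd c ` S) (F \<circ> chart_inv c)" "p \<in> S"
  shows "chart_deriv c F p (frechet_derivative (F \<circ> chart_inv c) (at (snd c p)))"
  unfolding chart_deriv_def by (rule smooth_on_has_derivative[OF assms(1)]) (use assms(2) in blast)

lemma chart_deriv_apply_linear:
  fixes M :: "'a::topological_space \<Rightarrow> 'f::real_inner \<Rightarrow> 'v::real_normed_vector"
  assumes fd: "finite_dim TYPE('f)" and c: "is_chart c" "p \<in> fst c" and W: "open W" "p \<in> W"
    and lin: "\<And>q. q \<in> fst c \<Longrightarrow> q \<in> W \<Longrightarrow> linear (M q)"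
    and M: "\<And>v. chart_deriv c (\<lambda>q. M q v) p (\<lambda>u. M' u v)"
    and z: "chart_deriv c z p z'"
  shows "chart_deriv c (\<lambda>q. M q (z q)) p (\<lambda>u. M' u (z p) + M p (z' u))"
proof -
  have "((\<lambda>x. M (chart_inv c x) ((z \<circ> chart_inv c) x)) has_derivative
      (\<lambda>u. M' u ((z \<circ> chart_inv c) (snd c p)) + M (chart_inv c (snd c p)) (z' u))) (at (snd c p))"
    by (rule has_derivative_apply_linear[OF fd open_chart_image[OF c(1) W(1)]])
       (use c W lin M z in \<open>auto simp: chart_deriv_def o_def chart_inv_eq\<close>)
  then show ?thesis by (simp add: chart_deriv_def o_def chart_inv_eq[OF c])
qed

lemma chart_deriv_family_linear:
  assumes c: "is_chart c" "p \<in> fst c" and W: "open W" "p \<in> W"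
    and lin: "\<And>q. q \<in> fst c \<Longrightarrow> q \<in> W \<Longrightarrow> linear (M q)"
    and M: "\<And>v. chart_deriv c (\<lambda>q. M q v) p (\<lambda>u. M' u v)"
  shows "linear (M' u)"
  by (rule has_derivative_family_linear[OF open_chart_image[OF c(1) W(1)], of "snd c p" "\<lambda>x. M (chart_inv c x)"])
     (use c W lin M in \<open>auto simp: chart_deriv_def o_def chart_inv_eq\<close>)

section \<open>Tangent coordinates and change of charts\<close>

locale manifold =
  fixes A :: "('a::{t2_space,second_countable_topology}, 'e::real_inner) chart set"
  assumes atlas: "smooth_atlas A"
begin

lemma finite_dim: "finite_dim TYPE('e)"
  using atlas by (simp add: smooth_atlas_def)

lemma is_chart: "c \<in> A \<Longrightarrow> is_chart c"
  using atlas by (simp add: smooth_atlas_def)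

lemma chart_at: "chart_at A p \<in> A" "p \<in> fst (chart_at A p)"
proof -
  have "\<exists>c. c \<in> A \<and> p \<in> fst c" using atlas unfolding smooth_atlas_def by blast
  from someI_ex[OF this] show "chart_at A p \<in> A" "p \<in> fst (chart_at A p)"
    by (simp_all add: chart_at_def)
qed

lemmas is_chart_at = is_chart[OF chart_at(1)]

lemma transition:
  assumes "c \<in> A" "d \<in> A" "q \<in> fst c" "q \<in> fst d"
  shows "chart_deriv c (snd d) q (frechet_derivative (snd d \<circ> chart_inv c) (at (snd c q)))"
  using atlas assms by (intro chart_deriv_smooth[of _ "fst c \<inter> fst d"]) (auto simp: smooth_atlas_def)

lemma coord_deriv:
  assumes "c \<in> A" "q \<in> fst c"
  shows "chart_deriv (chart_at A q) (snd c) q (coord A c q)"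
  using transition[OF chart_at(1) assms(1) chart_at(2) assms(2)]
  by (simp add: coord_def[abs_def] dir_deriv_def)

lemma coord_field_deriv:
  assumes "c \<in> A" "q \<in> fst c"
  shows "chart_deriv c (snd (chart_at A q)) q (\<lambda>x. coord_field A c x q)"
  using transition[OF assms(1) chart_at(1) assms(2) chart_at(2)]
  by (simp add: coord_field_def)

lemma change_chart:
  assumes "chart_deriv d F q F'" "chart_deriv c (snd d) q L" "c \<in> A" "d \<in> A" "q \<in> fst c" "q \<in> fst d"
  shows "chart_deriv c F q (\<lambda>u. F' (L u))"
  using chart_deriv_chain[of c q d "\<lambda>x. x" L F F'] assms
  by (simp add: is_chart o_def)

lemma change_to_chart_at:
  "chart_deriv c F q F' \<Longrightarrow> c \<in> A \<Longrightarrow> q \<in> fst c \<Longrightarrow>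
    chart_deriv (chart_at A q) F q (\<lambda>u. F' (coord A c q u))"
  by (rule change_chart[OF _ coord_deriv]) (simp_all add: chart_at)

lemma change_from_chart_at:
  "chart_deriv (chart_at A q) F q F' \<Longrightarrow> c \<in> A \<Longrightarrow> q \<in> fst c \<Longrightarrow>
    chart_deriv c F q (\<lambda>u. F' (coord_field A c u q))"
  by (rule change_chart[OF _ coord_field_deriv]) (simp_all add: chart_at)

text \<open>Both conversions are derivatives of transition maps, so by the chain rule their
  composition is the derivative of \<open>snd c\<close> in the chart \<open>c\<close>, which is the
  identity.\<close>

lemma coord_coord_field:
  assumes "c \<in> A" "q \<in> fst c"
  shows "coord A c q (coord_field A c x q) = x"
  by (rule fun_cong[OF chart_deriv_unique[OF change_from_chart_at[OF coord_deriv[OF assms] assms]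
      chart_deriv_self[OF is_chart[OF assms(1)] assms(2)]]])

lemma coord_field_coord:
  assumes "c \<in> A" "q \<in> fst c"
  shows "coord_field A c (coord A c q u) q = u"
  by (rule fun_cong[OF chart_deriv_unique[OF change_to_chart_at[OF coord_field_deriv[OF assms] assms]
      chart_deriv_self[OF is_chart_at chart_at(2)]]])

lemma linear_coord: "c \<in> A \<Longrightarrow> q \<in> fst c \<Longrightarrow> linear (coord A c q)"
  by (rule chart_deriv_linear[OF coord_deriv])

lemma linear_coord_field: "c \<in> A \<Longrightarrow> q \<in> fst c \<Longrightarrow> linear (\<lambda>x. coord_field A c x q)"
  by (rule chart_deriv_linear[OF coord_field_deriv])

lemma coord_chart_at: "coord A (chart_at A p) p u = u"
  by (rule fun_cong[OF chart_deriv_unique[OF coord_deriv[OF chart_at] chart_deriv_self[OF is_chart_at chart_at(2)]]])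

lemma coord_field_chart_at: "coord_field A (chart_at A p) x p = x"
  using coord_field_coord[OF chart_at, of p x] by (simp add: coord_chart_at)

end

section \<open>Smooth maps and their differentials\<close>

locale manifold_map = S: manifold A + T: manifold B
  for A :: "('a::{t2_space,second_countable_topology}, 'e::real_inner) chart set"
    and B :: "('b::{t2_space,second_countable_topology}, 'f::real_inner) chart set" +
  fixes \<phi> :: "'a \<Rightarrow> 'b"
  assumes smooth: "smooth_map A B \<phi>"
begin

lemma continuous: "continuous_on UNIV \<phi>"
  using smooth by (simp add: smooth_map_def)

lemma smooth_local:
  "c \<in> A \<Longrightarrow> d \<in> B \<Longrightarrow> smooth_on (snd c ` (fst c \<inter> \<phi> -` fst d)) (snd d \<circ> \<phi> \<circ> chart_inv c)"
  using smooth by (simp add: smooth_map_def)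

lemma deriv_local:
  assumes "c \<in> A" "d \<in> B" "q \<in> fst c" "\<phi> q \<in> fst d"
  shows "chart_deriv c (snd d \<circ> \<phi>) q (frechet_derivative (snd d \<circ> \<phi> \<circ> chart_inv c) (at (snd c q)))"
  by (rule chart_deriv_smooth[OF smooth_local]) (use assms in auto)

lemma tangent_map_deriv:
  "chart_deriv (chart_at A q) (snd (chart_at B (\<phi> q)) \<circ> \<phi>) q (tangent_map A B \<phi> q)"
  using deriv_local[OF S.chart_at(1) T.chart_at(1) S.chart_at(2) T.chart_at(2)]
  by (simp add: tangent_map_def[abs_def] dir_deriv_def)

lemma linear_tangent_map: "linear (tangent_map A B \<phi> q)"
  by (rule chart_deriv_linear[OF tangent_map_deriv])

lemma pullback_deriv:
  "chart_deriv (chart_at B (\<phi> q)) F (\<phi> q) F' \<Longrightarrow>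
    chart_deriv (chart_at A q) (\<lambda>q. F (\<phi> q)) q (\<lambda>u. F' (tangent_map A B \<phi> q u))"
  using chart_deriv_chain[OF S.is_chart_at S.chart_at(2) T.is_chart_at T.chart_at(2) continuous tangent_map_deriv]
  by (simp add: o_def)

text \<open>In fixed charts the differential is the Frechet derivative of one smooth local
  expression at all nearby points; this frees it from the charts that vary with the point, so that
  it can be differentiated in turn.\<close>

lemma coord_tangent_map:
  assumes "c \<in> A" "d \<in> B" "q \<in> fst c" "\<phi> q \<in> fst d"
  shows "coord B d (\<phi> q) (tangent_map A B \<phi> q u) =
    frechet_derivative (snd d \<circ> \<phi> \<circ> chart_inv c) (at (snd c q)) (coord A c q u)"
proof -
  have "chart_deriv (chart_at A q) (snd d \<circ> \<phi>) q (\<lambda>u. coord B d (\<phi> q) (tangent_map A B \<phi> q u))"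
    using pullback_deriv[OF T.coord_deriv[OF assms(2,4)]] by (simp add: o_def)
  from fun_cong[OF chart_deriv_unique[OF this S.change_to_chart_at[OF deriv_local[OF assms] assms(1,3)]]]
  show ?thesis .
qed

lemma tangent_map_local:
  assumes "c = chart_at A p" "d = chart_at B (\<phi> p)"
  shows "frechet_derivative (snd d \<circ> \<phi> \<circ> chart_inv c) (at (snd c p)) = tangent_map A B \<phi> p"
  unfolding assms
  by (rule chart_deriv_unique[OF deriv_local tangent_map_deriv]) (simp_all add: S.chart_at T.chart_at)

text \<open>Differentiating the relation between the fields in charts produces the second derivative
  of the local expression on \<open>X p\<close> and \<open>Y p\<close>. It is symmetric, so it
  cancels in the bracket.\<close>

lemma related_bracket:
  assumes relX: "\<And>q. tangent_map A B \<phi> q (X q) = X' (\<phi> q)"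
    and relY: "\<And>q. tangent_map A B \<phi> q (Y q) = Y' (\<phi> q)"
    and X: "chart_deriv (chart_at A p) (\<lambda>q. coord A (chart_at A p) q (X q)) p X1"
    and Y: "chart_deriv (chart_at A p) (\<lambda>q. coord A (chart_at A p) q (Y q)) p Y1"
    and X': "chart_deriv (chart_at B (\<phi> p)) (\<lambda>q. coord B (chart_at B (\<phi> p)) q (X' q)) (\<phi> p) X1'"
    and Y': "chart_deriv (chart_at B (\<phi> p)) (\<lambda>q. coord B (chart_at B (\<phi> p)) q (Y' q)) (\<phi> p) Y1'"
  shows "tangent_map A B \<phi> p (lie_bracket A X Y p) = lie_bracket B X' Y' (\<phi> p)"
proof -
  define c d where "c = chart_at A p" and "d = chart_at B (\<phi> p)"
  have c: "c \<in> A" "p \<in> fst c" "is_chart c" and d: "d \<in> B" "\<phi> p \<in> fst d" "is_chart d"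
    by (simp_all add: c_def d_def S.chart_at T.chart_at S.is_chart_at T.is_chart_at)
  define f where "f = snd d \<circ> \<phi> \<circ> chart_inv c"
  define W where "W = \<phi> -` fst d"
  have W: "open W" "p \<in> W"
    using continuous d by (auto simp: W_def is_chart_def intro: open_vimage)
  let ?S = "snd c ` (fst c \<inter> W)"
  have S: "open ?S" "snd c p \<in> ?S" using c W open_chart_image[OF c(3) W(1)] by auto
  have f: "smooth_on ?S f" unfolding f_def W_def by (rule smooth_local[OF c(1) d(1)])
  let ?P = "\<lambda>q. frechet_derivative f (at (snd c q))"
  let ?H = "\<lambda>u v. frechet_derivative (\<lambda>x. frechet_derivative f (at x) v) (at (snd c p)) u"
  have T: "?P p = tangent_map A B \<phi> p"
    unfolding f_def by (rule tangent_map_local) (simp_all add: c_def d_def)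
  have linP: "linear (?P q)" if "q \<in> fst c" "q \<in> W" for q
    by (rule has_derivative_linear[OF smooth_on_has_derivative[OF f]]) (use that in simp)
  have H: "chart_deriv c (\<lambda>q. ?P q v) p (\<lambda>u. ?H u v)" for v
  proof -
    have "((\<lambda>x. frechet_derivative f (at x) v) has_derivative (\<lambda>u. ?H u v)) (at (snd c p))"
      using smooth_on_has_derivative[OF smooth_on_frechet[OF f] S(2)] .
    then show ?thesis unfolding chart_deriv_def
      by (rule has_derivative_transform_within_open[OF _ S]) (use c in \<open>auto simp: chart_inv_eq\<close>)
  qed
  \<comment> \<open>The field \<open>Z'\<close> along \<phi> is differentiated in direction
    \<open>u\<close> in two ways: by pull-back from the target, and by the product rule for
    \<open>?P q\<close> applied to the coordinates of \<open>Z\<close>.\<close>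
  have key: "Z1' (tangent_map A B \<phi> p u) = ?H u (Z p) + tangent_map A B \<phi> p (Z1 u)"
    if rel: "\<And>q. tangent_map A B \<phi> q (Z q) = Z' (\<phi> q)"
      and Z: "chart_deriv c (\<lambda>q. coord A c q (Z q)) p Z1"
      and Z': "chart_deriv d (\<lambda>q. coord B d q (Z' q)) (\<phi> p) Z1'"
    for Z Z' Z1 Z1' u
  proof -
    have "chart_deriv c (\<lambda>q. ?P q (coord A c q (Z q))) p (\<lambda>u. ?H u (coord A c p (Z p)) + ?P p (Z1 u))"
      by (rule chart_deriv_apply_linear[OF S.finite_dim c(3,2) W linP H Z])
    then have "chart_deriv c (\<lambda>q. coord B d (\<phi> q) (Z' (\<phi> q))) p (\<lambda>u. ?H u (coord A c p (Z p)) + ?P p (Z1 u))"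
      by (rule chart_deriv_cong[OF c(3,2) W, rotated])
         (use coord_tangent_map[OF c(1) d(1)] in \<open>auto simp: rel[symmetric] W_def f_def\<close>)
    moreover have "chart_deriv c (\<lambda>q. coord B d (\<phi> q) (Z' (\<phi> q))) p (\<lambda>u. Z1' (tangent_map A B \<phi> p u))"
      using pullback_deriv Z' unfolding c_def d_def by blast
    ultimately have "(\<lambda>u. ?H u (coord A c p (Z p)) + ?P p (Z1 u)) = (\<lambda>u. Z1' (tangent_map A B \<phi> p u))"
      by (rule chart_deriv_unique)
    from fun_cong[OF this, of u] show ?thesis
      using S.coord_chart_at[of p "Z p"] by (simp add: T flip: c_def)
  qed
  have sym: "?H u v = ?H v u" for u v
    by (rule second_derivative_symmetric[OF S f])
  have "lie_bracket A X Y p = Y1 (X p) - X1 (Y p)"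
    unfolding lie_bracket_def chart_deriv_dir_deriv[OF X] chart_deriv_dir_deriv[OF Y] ..
  moreover have "lie_bracket B X' Y' (\<phi> p) = Y1' (X' (\<phi> p)) - X1' (Y' (\<phi> p))"
    unfolding lie_bracket_def chart_deriv_dir_deriv[OF X'] chart_deriv_dir_deriv[OF Y'] ..
  moreover have "Y1' (X' (\<phi> p)) = ?H (X p) (Y p) + tangent_map A B \<phi> p (Y1 (X p))"
    unfolding relX[symmetric] by (rule key[OF relY Y[folded c_def] Y'[folded d_def]])
  moreover have "X1' (Y' (\<phi> p)) = ?H (Y p) (X p) + tangent_map A B \<phi> p (X1 (Y p))"
    unfolding relY[symmetric] by (rule key[OF relX X[folded c_def] X'[folded d_def]])
  ultimately show ?thesis
    by (simp add: linear_diff[OF linear_tangent_map] sym[of "X p"])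
qed

end

lemma tangent_map_compose:
  assumes "manifold_map A B \<phi>" "manifold_map B C \<psi>"
  shows "tangent_map A C (\<psi> \<circ> \<phi>) q u = tangent_map B C \<psi> (\<phi> q) (tangent_map A B \<phi> q u)"
proof -
  interpret P: manifold_map A B \<phi> by fact
  interpret Q: manifold_map B C \<psi> by fact
  show ?thesis
    using chart_deriv_dir_deriv[OF P.pullback_deriv[OF Q.tangent_map_deriv]]
    by (simp add: tangent_map_def[of A C] o_def)
qed

lemma tangent_map_id:
  assumes "manifold A"
  shows "tangent_map A A (\<lambda>x. x) q u = u"
proof -
  interpret manifold A by fact
  show ?thesis
    using chart_deriv_dir_deriv[OF chart_deriv_self[OF is_chart_at chart_at(2)]]
    by (simp add: tangent_map_def o_def)
qed

section \<open>The Levi-Civita connection\<close>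

locale riemannian = manifold A
  for A :: "('a::{t2_space,second_countable_topology}, 'e::real_inner) chart set" +
  fixes g :: "'a \<Rightarrow> 'e \<Rightarrow> 'e \<Rightarrow> real"
  assumes metric: "riemannian_metric A g"
begin

lemma scalar_product: "scalar_product (g p)"
  by (rule scalar_product.intro[OF finite_dim]) (use metric in \<open>auto simp: riemannian_metric_def\<close>)

lemma metric_commute: "g p u v = g p v u"
  using metric by (simp add: riemannian_metric_def)

lemmas metric_right = scalar_product.right_simps[OF scalar_product]
lemmas metric_left = scalar_product.left_simps[OF scalar_product]

text \<open>The classical partial derivatives of the metric coefficients; they depend on the chart
  selected at \<open>p\<close>.\<close>

definition metric_deriv :: "'a \<Rightarrow> 'e \<Rightarrow> 'e \<Rightarrow> 'e \<Rightarrow> real" where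
  "metric_deriv p u a b = dir_deriv A p
     (\<lambda>q. g q (coord_field A (chart_at A p) a q) (coord_field A (chart_at A p) b q)) u"

lemma metric_deriv:
  "chart_deriv (chart_at A p) (\<lambda>q. g q (coord_field A (chart_at A p) a q) (coord_field A (chart_at A p) b q)) p
     (\<lambda>u. metric_deriv p u a b)"
proof -
  have "chart_deriv (chart_at A p) (\<lambda>q. g q (coord_field A (chart_at A p) a q) (coord_field A (chart_at A p) b q)) p
     (frechet_derivative ((\<lambda>q. g q (coord_field A (chart_at A p) a q) (coord_field A (chart_at A p) b q)) \<circ>
       chart_inv (chart_at A p)) (at (snd (chart_at A p) p)))"
    using metric chart_at by (intro chart_deriv_smooth[of _ "fst (chart_at A p)"]) (auto simp: riemannian_metric_def)
  then show ?thesis by (simp add: metric_deriv_def dir_deriv_def)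
qed

lemma metric_deriv_commute: "metric_deriv p u a b = metric_deriv p u b a"
  by (simp add: metric_deriv_def metric_commute)

lemma linear_metric_field:
  assumes "c \<in> A" "q \<in> fst c"
  shows "linear (\<lambda>b. g q X (coord_field A c b q))"
  using linear_compose[OF linear_coord_field[OF assms] scalar_product.linear_right[OF scalar_product]]
  by (simp add: o_def)

lemma linear_metric_deriv: "linear (metric_deriv p u a)"
  by (rule chart_deriv_family_linear[OF is_chart_at chart_at(2) open_UNIV UNIV_I _ metric_deriv])
     (rule linear_metric_field[OF chart_at(1)])

lemma linear_metric_deriv_dir: "linear (\<lambda>u. metric_deriv p u a b)"
  by (rule chart_deriv_linear[OF metric_deriv])

text \<open>Fields are written as \<open>coord_field\<close> of their coordinates, and the product
  rule for a linear family is applied once in each slot of \<open>g\<close>.\<close>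

lemma metric_product_rule:
  assumes Y: "chart_deriv (chart_at A p) (\<lambda>q. coord A (chart_at A p) q (Y q)) p Y1"
    and Z: "chart_deriv (chart_at A p) (\<lambda>q. coord A (chart_at A p) q (Z q)) p Z1"
  shows "chart_deriv (chart_at A p) (\<lambda>q. g q (Y q) (Z q)) p
    (\<lambda>u. metric_deriv p u (Y p) (Z p) + g p (Y p) (Z1 u) + g p (Y1 u) (Z p))"
proof -
  let ?c = "chart_at A p" and ?D = "coord_field A (chart_at A p)"
  note here = is_chart_at[of p] chart_at(2)[of p] open_UNIV UNIV_I
  have 1: "chart_deriv ?c (\<lambda>q. g q (?D a q) (Z q)) p (\<lambda>u. metric_deriv p u a (Z p) + g p a (Z1 u))" for a
  proof -
    have "chart_deriv ?c (\<lambda>q. g q (?D a q) (?D (coord A ?c q (Z q)) q)) p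
        (\<lambda>u. metric_deriv p u a (coord A ?c p (Z p)) + g p (?D a p) (?D (Z1 u) p))"
      by (rule chart_deriv_apply_linear[OF finite_dim here linear_metric_field[OF chart_at(1)] metric_deriv Z])
    then have "chart_deriv ?c (\<lambda>q. g q (?D a q) (?D (coord A ?c q (Z q)) q)) p
        (\<lambda>u. metric_deriv p u a (Z p) + g p a (Z1 u))"
      by (simp add: coord_chart_at coord_field_chart_at)
    then show ?thesis
      by (rule chart_deriv_cong[OF here, rotated]) (simp add: coord_field_coord[OF chart_at(1)])
  qed
  have "chart_deriv ?c (\<lambda>q. g q (?D (coord A ?c q (Y q)) q) (Z q)) p
      (\<lambda>u. (metric_deriv p u (coord A ?c p (Y p)) (Z p) + g p (coord A ?c p (Y p)) (Z1 u)) + g p (?D (Y1 u) p) (Z p))"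
    by (rule chart_deriv_apply_linear[OF finite_dim here _ 1 Y])
       (use linear_metric_field[OF chart_at(1)] in \<open>simp add: metric_commute[of _ _ "Z _"]\<close>)
  then have "chart_deriv ?c (\<lambda>q. g q (?D (coord A ?c q (Y q)) q) (Z q)) p
      (\<lambda>u. metric_deriv p u (Y p) (Z p) + g p (Y p) (Z1 u) + g p (Y1 u) (Z p))"
    by (simp add: coord_chart_at coord_field_chart_at)
  then show ?thesis
    by (rule chart_deriv_cong[OF here, rotated]) (simp add: coord_field_coord[OF chart_at(1)])
qed

text \<open>The right-hand side is linear in \<open>z\<close>, so \<open>riesz\<close> shows that
  the description in \<open>christoffel\<close> denotes.\<close>

lemma christoffel_eq:
  "2 * g p (christoffel A g p u v) z =
    metric_deriv p u v z + metric_deriv p v u z - metric_deriv p z u v"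
proof -
  let ?l = "\<lambda>z. (metric_deriv p u v z + metric_deriv p v u z - metric_deriv p z u v) / 2"
  interpret scalar_product "g p" by (rule scalar_product)
  have l: "linear ?l"
    by (rule linearI)
       (simp_all add: linear_add[OF linear_metric_deriv] linear_add[OF linear_metric_deriv_dir]
         linear_cmul[OF linear_metric_deriv] linear_cmul[OF linear_metric_deriv_dir] field_simps)
  have "christoffel A g p u v = (THE w. \<forall>z. g p w z = ?l z)"
    unfolding christoffel_def Let_def metric_deriv_def[symmetric]
    by (rule arg_cong[where f = The]) (auto simp: fun_eq_iff field_simps)
  then have "\<forall>z. g p (christoffel A g p u v) z = ?l z" using theI'[OF riesz[OF l]] by presburger
  then have "g p (christoffel A g p u v) z = ?l z" by blast
  then show ?thesis by (simp add: field_simps)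
qed

lemma christoffel_linear_right: "linear (christoffel A g p u)"
proof -
  interpret scalar_product "g p" by (rule scalar_product)
  show ?thesis
  proof (rule linearI; rule nondegenerate)
    fix v w z
    have "2 * g p (christoffel A g p u (v + w)) z = 2 * g p (christoffel A g p u v) z + 2 * g p (christoffel A g p u w) z"
      unfolding christoffel_eq
      by (simp add: linear_add[OF linear_metric_deriv] linear_add[OF linear_metric_deriv_dir]
         metric_deriv_commute[of _ _ "_ + _"])
         (simp add: metric_deriv_commute)
    then show "g p (christoffel A g p u (v + w)) z = g p (christoffel A g p u v + christoffel A g p u w) z"
      by (simp add: left_simps)
  next
    fix r v z
    have "2 * g p (christoffel A g p u (r *\<^sub>R v)) z = r * (2 * g p (christoffel A g p u v) z)"
      unfolding christoffel_eq
      by (simp add: linear_cmul[OF linear_metric_deriv] linear_cmul[OF linear_metric_deriv_dir]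
         metric_deriv_commute[of _ _ "_ *\<^sub>R _"])
         (simp add: metric_deriv_commute algebra_simps)
    then show "g p (christoffel A g p u (r *\<^sub>R v)) z = g p (r *\<^sub>R christoffel A g p u v) z"
      by (simp add: left_simps)
  qed
qed

lemma christoffel_commute: "christoffel A g p u v = christoffel A g p v u"
proof (rule scalar_product.nondegenerate[OF scalar_product])
  fix z
  show "g p (christoffel A g p u v) z = g p (christoffel A g p v u) z"
    using christoffel_eq[of p u v z] christoffel_eq[of p v u z] by (simp add: metric_deriv_commute[of _ _ v u])
qed

lemma levi_civita_deriv:
  assumes "chart_deriv (chart_at A p) (\<lambda>q. coord A (chart_at A p) q (Y q)) p Y1"
  shows "levi_civita A g X Y p = Y1 (X p) + christoffel A g p (X p) (Y p)"
  by (simp add: levi_civita_def chart_deriv_dir_deriv[OF assms])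

text \<open>The six-term Koszul formula loses its three derivative terms because the products of the
  fields are constant. The three vanishing derivatives are combined with the signs of the
  Christoffel formula, and the derivatives of the fields assemble into brackets.\<close>

lemma koszul:
  assumes X: "chart_deriv (chart_at A p) (\<lambda>q. coord A (chart_at A p) q (X q)) p X1"
    and Y: "chart_deriv (chart_at A p) (\<lambda>q. coord A (chart_at A p) q (Y q)) p Y1"
    and Z: "chart_deriv (chart_at A p) (\<lambda>q. coord A (chart_at A p) q (Z q)) p Z1"
    and const: "\<And>q. g q (X q) (Y q) = g p (X p) (Y p)" "\<And>q. g q (X q) (Z q) = g p (X p) (Z p)"
      "\<And>q. g q (Y q) (Z q) = g p (Y p) (Z p)"
  shows "2 * g p (levi_civita A g X Y p) (Z p) =
    g p (lie_bracket A X Y p) (Z p) + g p (Y p) (lie_bracket A Z X p) + g p (X p) (lie_bracket A Z Y p)"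
proof -
  have zero: "metric_deriv p u (V p) (W p) + g p (V p) (W1 u) + g p (V1 u) (W p) = 0"
    if "chart_deriv (chart_at A p) (\<lambda>q. coord A (chart_at A p) q (V q)) p V1"
      "chart_deriv (chart_at A p) (\<lambda>q. coord A (chart_at A p) q (W q)) p W1"
      "\<And>q. g q (V q) (W q) = g p (V p) (W p)" for V W V1 W1 u
  proof -
    have "(\<lambda>q. g q (V q) (W q)) = (\<lambda>q. g p (V p) (W p))" by (rule ext) (rule that(3))
    then have "chart_deriv (chart_at A p) (\<lambda>q. g q (V q) (W q)) p (\<lambda>u. 0)"
      by (metis chart_deriv_const)
    from fun_cong[OF chart_deriv_unique[OF metric_product_rule[OF that(1,2)] this], of u]
    show ?thesis .
  qed
  have br: "lie_bracket A V W p = W1 (V p) - V1 (W p)"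
    if "chart_deriv (chart_at A p) (\<lambda>q. coord A (chart_at A p) q (V q)) p V1"
      "chart_deriv (chart_at A p) (\<lambda>q. coord A (chart_at A p) q (W q)) p W1" for V W V1 W1
    by (simp add: lie_bracket_def chart_deriv_dir_deriv[OF that(1)] chart_deriv_dir_deriv[OF that(2)])
  show ?thesis
    using zero[OF Y Z const(3), of "X p"] zero[OF X Z const(2), of "Y p"] zero[OF X Y const(1), of "Z p"]
      christoffel_eq[of p "X p" "Y p" "Z p"]
    by (simp add: br[OF X Y] br[OF Z X] br[OF Z Y] levi_civita_deriv[OF Y] metric_left metric_right
        metric_commute[of p "Z1 _"] metric_commute[of p "X p" "Y1 _"])
       (simp add: metric_commute)
qed

end

section \<open>Lie groups\<close>

definition prod_chart :: "('a, 'e) chart \<Rightarrow> ('b, 'f) chart \<Rightarrow> ('a \<times> 'b, 'e \<times> 'f) chart" where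
  "prod_chart c d = (fst c \<times> fst d, map_prod (snd c) (snd d))"

text \<open>A chart inverse is an \<open>inv_into\<close>, so its splitting rests on injectivity of
  the product map on the product of the domains.\<close>

lemma prod_chart_inv:
  assumes "is_chart c" "is_chart d" "x \<in> snd c ` fst c" "y \<in> snd d ` fst d"
  shows "chart_inv (prod_chart c d) (x, y) = (chart_inv c x, chart_inv d y)"
proof -
  obtain p q where pq: "p \<in> fst c" "x = snd c p" "q \<in> fst d" "y = snd d q" using assms by auto
  have "inj_on (snd c) (fst c)" "inj_on (snd d) (fst d)"
    using assms(1,2) by (auto intro: inj_on_inverseI chart_inv_eq)
  then have "inj_on (map_prod (snd c) (snd d)) (fst c \<times> fst d)"
    by (rule map_prod_inj_on)
  from inv_into_f_f[OF this, of "(p, q)"] show ?thesis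
    using pq by (simp add: prod_chart_def chart_inv_eq assms)
qed

lemma is_chart_prod:
  assumes "is_chart c" "is_chart d"
  shows "is_chart (prod_chart c d)"
proof -
  let ?p = "prod_chart c d"
  have im: "snd ?p ` fst ?p = (snd c ` fst c) \<times> (snd d ` fst d)"
    by (auto simp: prod_chart_def)
  have f: "continuous_on (fst ?p) (snd ?p)"
    using assms unfolding is_chart_def homeomorphism_def prod_chart_def
    by (auto simp: map_prod_def case_prod_unfold
        intro!: continuous_on_Pair continuous_on_compose2[of "fst c" "snd c" _ fst] continuous_on_compose2[of "fst d" "snd d" _ snd]
          continuous_on_fst continuous_on_snd continuous_on_id)
  have "continuous_on (snd ?p ` fst ?p) (\<lambda>z. (chart_inv c (fst z), chart_inv d (snd z)))"
    using assms unfolding is_chart_def homeomorphism_def im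
    by (auto intro!: continuous_on_Pair continuous_on_compose2[of "snd c ` fst c" "chart_inv c" _ fst]
          continuous_on_compose2[of "snd d ` fst d" "chart_inv d" _ snd]
          continuous_on_fst continuous_on_snd continuous_on_id)
  then have g: "continuous_on (snd ?p ` fst ?p) (chart_inv ?p)"
    by (rule continuous_on_eq) (auto simp: im prod_chart_inv[OF assms])
  have inv: "chart_inv ?p (snd ?p z) = z" if "z \<in> fst ?p" for z
  proof -
    have "fst z \<in> fst c" "snd z \<in> fst d" using that by (auto simp: prod_chart_def)
    then show ?thesis
      using prod_chart_inv[OF assms, of "snd c (fst z)" "snd d (snd z)"] assms
      by (cases z) (auto simp: prod_chart_def chart_inv_eq)
  qed
  have "homeomorphism (fst ?p) (snd ?p ` fst ?p) (snd ?p) (chart_inv ?p)"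
    unfolding homeomorphism_def using f g inv by (force simp: f_inv_into_f)
  then show ?thesis
    using assms im unfolding is_chart_def by (auto simp: prod_chart_def intro: open_Times)
qed

section \<open>Translations and invariant fields\<close>

locale lie_group_loc =
  fixes G :: "'a::{t2_space,second_countable_topology} monoid" (structure)
    and A :: "('a, 'e::real_inner) chart set"
  assumes lie_group: "lie_group G A"

sublocale lie_group_loc \<subseteq> manifold A
  using lie_group by unfold_locales (simp add: lie_group_def)

sublocale lie_group_loc \<subseteq> group G
  using lie_group by (simp add: lie_group_def)

context lie_group_loc
begin

lemma carrier_UNIV [simp]: "x \<in> carrier G"
  using lie_group by (simp add: lie_group_def)

abbreviation "group_mult \<equiv> \<lambda>(x, y). x \<otimes> y"
abbreviation "left_field \<equiv> left_inv_field G A"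

lemma continuous_mult: "continuous_on UNIV group_mult"
  using lie_group by (simp add: lie_group_def smooth_map_def)

text \<open>Smoothness of multiplication enters through this local expression: translations are its
  slices, invariant fields its partial derivatives where one factor is the identity.\<close>

definition mult_local :: "('a, 'e) chart \<Rightarrow> ('a, 'e) chart \<Rightarrow> ('a, 'e) chart \<Rightarrow> 'e \<times> 'e \<Rightarrow> 'e" where
  "mult_local c d e = snd e \<circ> group_mult \<circ> chart_inv (prod_chart c d)"

definition mult_dom :: "('a, 'e) chart \<Rightarrow> ('a, 'e) chart \<Rightarrow> ('a, 'e) chart \<Rightarrow> ('e \<times> 'e) set" where
  "mult_dom c d e = snd (prod_chart c d) ` (fst (prod_chart c d) \<inter> group_mult -` fst e)"

lemma mult_dom_open:
  assumes "c \<in> A" "d \<in> A" "e \<in> A"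
  shows "open (mult_dom c d e)"
  unfolding mult_dom_def
  using assms is_chart[OF assms(3)]
  by (intro open_chart_image is_chart_prod is_chart open_vimage continuous_mult) (auto simp: is_chart_def)

lemma mult_domI:
  assumes "c \<in> A" "d \<in> A" "x \<in> snd c ` fst c" "y \<in> snd d ` fst d" "chart_inv c x \<otimes> chart_inv d y \<in> fst e"
  shows "(x, y) \<in> mult_dom c d e"
  unfolding mult_dom_def
  by (rule image_eqI[of _ _ "(chart_inv c x, chart_inv d y)"])
     (use assms in \<open>auto simp: prod_chart_def chart_chart_inv chart_inv_in\<close>)

lemma mult_local_smooth:
  assumes "c \<in> A" "d \<in> A" "e \<in> A"
  shows "smooth_on (mult_dom c d e) (mult_local c d e)"
proof -
  have "prod_chart c d \<in> product_atlas A A"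
    unfolding product_atlas_def prod_chart_def using assms by blast
  then show ?thesis
    using lie_group assms(3) unfolding lie_group_def smooth_map_def mult_dom_def mult_local_def by blast
qed

lemma mult_local_eq:
  assumes "c \<in> A" "d \<in> A" "x \<in> snd c ` fst c" "y \<in> snd d ` fst d"
  shows "mult_local c d e (x, y) = snd e (chart_inv c x \<otimes> chart_inv d y)"
  using assms by (simp add: mult_local_def prod_chart_inv is_chart)

lemma left_mult_map: "manifold_map A A (\<lambda>y. p \<otimes> y)"
proof (unfold_locales, unfold smooth_map_def, intro conjI ballI)
  have "continuous_on UNIV (group_mult \<circ> (\<lambda>y. (p, y)))"
    by (intro continuous_on_compose continuous_on_subset[OF continuous_mult] continuous_intros) auto
  then show c: "continuous_on UNIV (\<lambda>y. p \<otimes> y)" by (simp add: o_def)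
  fix c d assume cd: "c \<in> A" "d \<in> A"
  let ?c = "chart_at A p" and ?S = "snd c ` (fst c \<inter> (\<lambda>y. p \<otimes> y) -` fst d)"
  have S: "open ?S"
    using c cd is_chart by (intro open_chart_image open_vimage) (auto simp: is_chart_def)
  have in_S: "x \<in> snd c ` fst c" "p \<otimes> chart_inv c x \<in> fst d" if "x \<in> ?S" for x
    using that cd by (auto simp: chart_inv_eq is_chart)
  have p: "snd ?c p \<in> snd ?c ` fst ?c" "chart_inv ?c (snd ?c p) = p"
    by (simp_all add: chart_at chart_inv_eq is_chart)
  \<comment> \<open>The sum with \<open>(0, x)\<close> freezes the first argument of multiplication
    at \<open>p\<close> and presents the slice as an affine map of \<open>x\<close>.\<close>
  have "smooth_on ?S (\<lambda>x. mult_local ?c c d ((snd ?c p, 0) + (0, x)))"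
    by (rule smooth_on_affine[OF S _ mult_local_smooth[OF chart_at(1) cd]])
       (use in_S p cd in \<open>auto intro!: mult_domI bounded_linear_Pair bounded_linear_zero bounded_linear_ident simp: chart_at\<close>)
  then show "smooth_on ?S (snd d \<circ> (\<lambda>y. p \<otimes> y) \<circ> chart_inv c)"
    by (rule smooth_on_cong[OF S, rotated]) (use in_S p cd in \<open>simp add: mult_local_eq chart_at\<close>)
qed

lemma right_mult_map: "manifold_map A A (\<lambda>y. y \<otimes> p)"
proof (unfold_locales, unfold smooth_map_def, intro conjI ballI)
  have "continuous_on UNIV (group_mult \<circ> (\<lambda>y. (y, p)))"
    by (intro continuous_on_compose continuous_on_subset[OF continuous_mult] continuous_intros) auto
  then show c: "continuous_on UNIV (\<lambda>y. y \<otimes> p)" by (simp add: o_def)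
  fix c d assume cd: "c \<in> A" "d \<in> A"
  let ?c = "chart_at A p" and ?S = "snd c ` (fst c \<inter> (\<lambda>y. y \<otimes> p) -` fst d)"
  have S: "open ?S"
    using c cd is_chart by (intro open_chart_image open_vimage) (auto simp: is_chart_def)
  have in_S: "x \<in> snd c ` fst c" "chart_inv c x \<otimes> p \<in> fst d" if "x \<in> ?S" for x
    using that cd by (auto simp: chart_inv_eq is_chart)
  have p: "snd ?c p \<in> snd ?c ` fst ?c" "chart_inv ?c (snd ?c p) = p"
    by (simp_all add: chart_at chart_inv_eq is_chart)
  have "smooth_on ?S (\<lambda>x. mult_local c ?c d ((0, snd ?c p) + (x, 0)))"
    by (rule smooth_on_affine[OF S _ mult_local_smooth[OF cd(1) chart_at(1) cd(2)]])
       (use in_S p cd in \<open>auto intro!: mult_domI bounded_linear_Pair bounded_linear_zero bounded_linear_ident simp: chart_at\<close>)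
  then show "smooth_on ?S (snd d \<circ> (\<lambda>y. y \<otimes> p) \<circ> chart_inv c)"
    by (rule smooth_on_cong[OF S, rotated]) (use in_S p cd in \<open>simp add: mult_local_eq chart_at\<close>)
qed

lemma tangent_left_left_field:
  "tangent_map A A (\<lambda>y. p \<otimes> y) q (left_field v q) = left_field v (p \<otimes> q)"
proof -
  have "(\<lambda>y. p \<otimes> y) \<circ> (\<lambda>y. q \<otimes> y) = (\<lambda>y. (p \<otimes> q) \<otimes> y)" by (simp add: fun_eq_iff m_assoc)
  then show ?thesis
    using tangent_map_compose[OF left_mult_map left_mult_map, of p q \<one> v] by (simp add: left_inv_field_def)
qed

lemma left_field_one: "left_field v \<one> = v"
  using tangent_map_id[OF manifold_axioms, of \<one> v] by (simp add: left_inv_field_def)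

lemma linear_left_field: "linear (\<lambda>v. left_field v p)"
  unfolding left_inv_field_def by (rule manifold_map.linear_tangent_map[OF left_mult_map])

text \<open>The left Maurer-Cartan form at \<open>q\<close>, inverse to \<open>left_field\<close> at
  \<open>q\<close>.\<close>

definition left_coord :: "'a \<Rightarrow> 'e \<Rightarrow> 'e" where
  "left_coord q u = tangent_map A A (\<lambda>y. inv q \<otimes> y) q u"

lemma linear_left_coord: "linear (left_coord q)"
  unfolding left_coord_def[abs_def] by (rule manifold_map.linear_tangent_map[OF left_mult_map])

lemma left_field_left_coord: "left_field (left_coord q u) q = u"
proof -
  have "(\<lambda>y. q \<otimes> y) \<circ> (\<lambda>y. inv q \<otimes> y) = (\<lambda>y. y)" by (simp add: fun_eq_iff m_assoc[symmetric])
  then show ?thesis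
    using tangent_map_compose[OF left_mult_map left_mult_map, of q "inv q" q u] tangent_map_id[OF manifold_axioms]
    by (simp add: left_inv_field_def left_coord_def)
qed

lemma left_coord_left_field: "left_coord q (left_field v q) = v"
  unfolding left_coord_def tangent_left_left_field by (simp add: left_field_one)

text \<open>As a partial derivative of the smooth local multiplication the field visibly depends
  smoothly on \<open>q\<close>, although its definition uses a different translation at each
  point.\<close>

lemma coord_left_field:
  assumes c: "c \<in> A" "q \<in> fst c"
  defines "d \<equiv> chart_at A \<one>"
  shows "coord A c q (left_field v q) = frechet_derivative (mult_local c d c) (at (snd c q, snd d \<one>)) (0, v)"
proof -
  interpret M: manifold_map A A "\<lambda>y. q \<otimes> y" by (rule left_mult_map)
  have d: "d \<in> A" "\<one> \<in> fst d" by (simp_all add: d_def chart_at)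
  have inv: "chart_inv c (snd c q) = q" "chart_inv d (snd d \<one>) = \<one>" using c d by (simp_all add: chart_inv_eq is_chart)
  have "(snd c q, snd d \<one>) \<in> mult_dom c d c" using c d inv by (intro mult_domI) auto
  then have 1: "(mult_local c d c has_derivative frechet_derivative (mult_local c d c) (at (snd c q, snd d \<one>)))
      (at (snd c q, snd d \<one>))"
    by (rule smooth_on_has_derivative[OF mult_local_smooth[OF c(1) d(1) c(1)]])
  have "((\<lambda>x. (snd c q, x)) has_derivative (\<lambda>v. (0, v))) (at (snd d \<one>))"
    by (auto intro!: derivative_eq_intros)
  from has_derivative_compose[OF this 1]
  have "chart_deriv d (snd c \<circ> (\<lambda>y. q \<otimes> y)) \<one>
      (\<lambda>v. frechet_derivative (mult_local c d c) (at (snd c q, snd d \<one>)) (0, v))"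
    unfolding chart_deriv_def
    by (rule has_derivative_transform_within_open[OF _ open_chart_image[OF is_chart[OF d(1)] open_UNIV]])
       (use c d inv in \<open>auto simp: mult_local_eq\<close>)
  from fun_cong[OF chart_deriv_unique[OF this M.deriv_local[OF d(1) c(1) d(2)]], of v]
  show ?thesis using M.coord_tangent_map[OF d(1) c(1) d(2), of v] c(2) coord_chart_at[of \<one> v]
    by (simp add: left_inv_field_def d_def)
qed

text \<open>These are the right invariant fields, as partial derivatives in the first argument. They
  are differentiated at the identity, whence the chart selected there.\<close>

lemma coord_right_field:
  defines "d \<equiv> chart_at A \<one>"
  assumes c: "q \<in> fst d"
  shows "coord A d q (tangent_map A A (\<lambda>y. y \<otimes> q) \<one> v) =
    frechet_derivative (mult_local d d d) (at (snd d \<one>, snd d q)) (v, 0)"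
proof -
  interpret M: manifold_map A A "\<lambda>y. y \<otimes> q" by (rule right_mult_map)
  have d: "d \<in> A" "\<one> \<in> fst d" by (simp_all add: d_def chart_at)
  have inv: "chart_inv d (snd d q) = q" "chart_inv d (snd d \<one>) = \<one>" using c d by (simp_all add: chart_inv_eq is_chart)
  have "(snd d \<one>, snd d q) \<in> mult_dom d d d" using c d inv by (intro mult_domI) auto
  then have 1: "(mult_local d d d has_derivative frechet_derivative (mult_local d d d) (at (snd d \<one>, snd d q)))
      (at (snd d \<one>, snd d q))"
    by (rule smooth_on_has_derivative[OF mult_local_smooth[OF d(1) d(1) d(1)]])
  have "((\<lambda>x. (x, snd d q)) has_derivative (\<lambda>v. (v, 0))) (at (snd d \<one>))"
    by (auto intro!: derivative_eq_intros)
  from has_derivative_compose[OF this 1]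
  have "chart_deriv d (snd d \<circ> (\<lambda>y. y \<otimes> q)) \<one>
      (\<lambda>v. frechet_derivative (mult_local d d d) (at (snd d \<one>, snd d q)) (v, 0))"
    unfolding chart_deriv_def
    by (rule has_derivative_transform_within_open[OF _ open_chart_image[OF is_chart[OF d(1)] open_UNIV]])
       (use c d inv in \<open>auto simp: mult_local_eq\<close>)
  from fun_cong[OF chart_deriv_unique[OF this M.deriv_local[OF d(1) d(1) d(2)]], of v]
  show ?thesis using M.coord_tangent_map[OF d(1) d(1) d(2), of v] c coord_chart_at[of \<one> v]
    by (simp add: d_def)
qed

lemma left_field_smooth:
  assumes c: "c \<in> A"
  shows "smooth_on (snd c ` fst c) ((\<lambda>q. coord A c q (left_field v q)) \<circ> chart_inv c)"
proof -
  let ?d = "chart_at A \<one>" and ?S = "snd c ` fst c"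
  have S: "open ?S" using open_chart_image[OF is_chart[OF c] open_UNIV] by simp
  have one: "snd ?d \<one> \<in> snd ?d ` fst ?d" "chart_inv ?d (snd ?d \<one>) = \<one>"
    by (simp_all add: chart_at chart_inv_eq is_chart)
  have "smooth_on ?S (\<lambda>x. (\<lambda>z. frechet_derivative (mult_local c ?d c) (at z) (0, v)) ((0, snd ?d \<one>) + (x, 0)))"
    by (rule smooth_on_affine[OF S _ smooth_on_frechet[OF mult_local_smooth[OF c chart_at(1) c]]])
       (use one c in \<open>auto intro!: mult_domI bounded_linear_Pair bounded_linear_zero bounded_linear_ident simp: chart_at chart_inv_eq is_chart\<close>)
  then show ?thesis
    by (rule smooth_on_cong[OF S, rotated]) (use c in \<open>auto simp: coord_left_field chart_inv_eq is_chart\<close>)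
qed

text \<open>A chart-dependent derivative. At the identity, in the selected chart, antisymmetrising
  it gives the bracket, and adding the Christoffel symbols gives the connection on left invariant
  fields.\<close>

definition left_deriv :: "('a, 'e) chart \<Rightarrow> 'a \<Rightarrow> 'e \<Rightarrow> 'e \<Rightarrow> 'e" where
  "left_deriv c p u v = frechet_derivative ((\<lambda>q. coord A c q (left_field v q)) \<circ> chart_inv c) (at (snd c p)) u"

lemma left_field_deriv:
  "c \<in> A \<Longrightarrow> p \<in> fst c \<Longrightarrow> chart_deriv c (\<lambda>q. coord A c q (left_field v q)) p (\<lambda>u. left_deriv c p u v)"
  unfolding left_deriv_def by (rule chart_deriv_smooth[OF left_field_smooth])

lemma linear_coord_left_field: "c \<in> A \<Longrightarrow> q \<in> fst c \<Longrightarrow> linear (\<lambda>v. coord A c q (left_field v q))"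
  using linear_compose[OF linear_left_field linear_coord] by (simp add: o_def)

lemma linear_left_deriv: "c \<in> A \<Longrightarrow> p \<in> fst c \<Longrightarrow> linear (left_deriv c p u)"
  by (rule chart_deriv_family_linear[OF is_chart _ open_UNIV UNIV_I linear_coord_left_field left_field_deriv])

lemma linear_left_deriv_dir: "c \<in> A \<Longrightarrow> p \<in> fst c \<Longrightarrow> linear (\<lambda>u. left_deriv c p u v)"
  by (rule chart_deriv_linear[OF left_field_deriv])

lemma bracket_left_deriv:
  "lie_bracket A (left_field u) (left_field v) p =
    left_deriv (chart_at A p) p (left_field u p) v - left_deriv (chart_at A p) p (left_field v p) u"
  by (simp add: lie_bracket_def chart_deriv_dir_deriv[OF left_field_deriv[OF chart_at]])

abbreviation "bracket \<equiv> ad G A"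

text \<open>A left invariant field is related to itself by every left translation, so the bracket of
  two is again left invariant.\<close>

lemma bracket_left_fields: "lie_bracket A (left_field u) (left_field v) p = left_field (bracket u v) p"
proof -
  interpret M: manifold_map A A "\<lambda>y. p \<otimes> y" by (rule left_mult_map)
  have "tangent_map A A (\<lambda>y. p \<otimes> y) \<one> (lie_bracket A (left_field u) (left_field v) \<one>) =
      lie_bracket A (left_field u) (left_field v) (p \<otimes> \<one>)"
    by (rule M.related_bracket[OF tangent_left_left_field tangent_left_left_field]) (rule left_field_deriv[OF chart_at])+
  then show ?thesis by (simp add: ad_def left_inv_field_def)
qed

lemma bracket_eq: "bracket u v = left_deriv (chart_at A \<one>) \<one> u v - left_deriv (chart_at A \<one>) \<one> v u"
  by (simp add: ad_def bracket_left_deriv left_field_one)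

lemma bracket_commute: "bracket u v = - bracket v u"
  by (simp add: bracket_eq)

lemma linear_bracket: "linear (bracket u)"
  unfolding bracket_eq[abs_def]
  by (intro linear_compose_sub linear_left_deriv linear_left_deriv_dir chart_at)

end

section \<open>Left invariant metrics\<close>

locale riemannian_lie_group_loc =
  fixes G :: "'a::{t2_space,second_countable_topology} monoid" (structure)
    and A :: "('a, 'e::real_inner) chart set"
    and g :: "'a \<Rightarrow> 'e \<Rightarrow> 'e \<Rightarrow> real"
  assumes riemannian_lie_group: "riemannian_lie_group G A g"

sublocale riemannian_lie_group_loc \<subseteq> lie_group_loc G A
  using riemannian_lie_group by unfold_locales (simp add: riemannian_lie_group_def)

sublocale riemannian_lie_group_loc \<subseteq> riemannian A g
  using riemannian_lie_group by unfold_locales (simp add: riemannian_lie_group_def)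

context riemannian_lie_group_loc
begin

abbreviation "ip \<equiv> g \<one>"

lemma metric_left_fields: "g p (left_field u p) (left_field v p) = ip u v"
  using riemannian_lie_group unfolding riemannian_lie_group_def left_invariant_def left_inv_field_def
  by (metis carrier_UNIV r_one)

definition conn :: "'e \<Rightarrow> 'e \<Rightarrow> 'e" where
  "conn u v = levi_civita A g (left_field u) (left_field v) \<one>"

lemma levi_civita_left_deriv:
  "levi_civita A g X (left_field v) p =
    left_deriv (chart_at A p) p (X p) v + christoffel A g p (X p) (left_field v p)"
  by (rule levi_civita_deriv[OF left_field_deriv[OF chart_at]])

lemma koszul_left_fields:
  "2 * g p (levi_civita A g (left_field u) (left_field v) p) (left_field w p) =
    ip (bracket u v) w + ip v (bracket w u) + ip u (bracket w v)"
  using koszul[OF left_field_deriv[OF chart_at, where p = p and v = u]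
      left_field_deriv[OF chart_at, where p = p and v = v] left_field_deriv[OF chart_at, where p = p and v = w]]
  by (simp add: metric_left_fields bracket_left_fields)

lemma koszul_conn: "2 * ip (conn u v) w = ip (bracket u v) w + ip v (bracket w u) + ip u (bracket w v)"
  using koszul_left_fields[of \<one> u v w] by (simp add: conn_def left_field_one)

text \<open>The Koszul expression for left invariant fields does not depend on the point; comparison
  with its value at the identity determines the derivative at \<open>p\<close>.\<close>

lemma levi_civita_left_fields: "levi_civita A g (left_field u) (left_field v) p = left_field (conn u v) p"
proof -
  let ?x = "left_coord p (levi_civita A g (left_field u) (left_field v) p)"
  have "ip ?x w = ip (conn u v) w" for w
    using koszul_left_fields[of p u v w] koszul_conn[of u v w] metric_left_fields[of p ?x w]
    by (simp add: left_field_left_coord)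
  then have "?x = conn u v" by (rule scalar_product.nondegenerate[OF scalar_product])
  then show ?thesis by (metis left_field_left_coord)
qed

lemma conn_eq: "conn u v = left_deriv (chart_at A \<one>) \<one> u v + christoffel A g \<one> u v"
  by (simp add: conn_def levi_civita_left_deriv left_field_one)

lemma linear_conn: "linear (conn u)"
  unfolding conn_eq[abs_def]
  by (intro linear_compose_add linear_left_deriv christoffel_linear_right chart_at)

lemma linear_conn_left: "linear (\<lambda>u. conn u v)"
  unfolding conn_eq christoffel_commute[of _ _ v]
  by (intro linear_compose_add linear_left_deriv_dir christoffel_linear_right chart_at)

lemma left_coord_expand:
  assumes "scalar_product.orthonormal ip e (dim (UNIV::'e set))"
  shows "left_coord q u = (\<Sum>j<dim (UNIV::'e set). g q u (left_field (e j) q) *\<^sub>R e j)"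
proof -
  have "left_coord q u = (\<Sum>j<dim (UNIV::'e set). ip (left_coord q u) (e j) *\<^sub>R e j)"
    by (rule scalar_product.orthonormal_expand[OF scalar_product assms])
  then show ?thesis
    by (simp add: metric_left_fields[of q, symmetric] left_field_left_coord)
qed

text \<open>Transfers differentiability from chart coordinates to left coordinates, for the frames
  chosen by \<open>SOME\<close>, which are known to be smooth only in charts.\<close>

lemma left_coord_differentiable:
  assumes "chart_deriv (chart_at A p) (\<lambda>q. coord A (chart_at A p) q (Y q)) p Y1"
  obtains Z1 where "chart_deriv (chart_at A p) (\<lambda>q. left_coord q (Y q)) p Z1"
proof -
  obtain e where e: "scalar_product.orthonormal ip e (dim (UNIV::'e set))"
    using scalar_product.orthonormal_exists[OF scalar_product] .
  have "\<exists>k'. chart_deriv (chart_at A p) (\<lambda>q. g q (Y q) (left_field (e j) q)) p k'" for j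
    using metric_product_rule[OF assms left_field_deriv[OF chart_at]] by blast
  then obtain k' where k': "\<And>j. chart_deriv (chart_at A p) (\<lambda>q. g q (Y q) (left_field (e j) q)) p (k' j)"
    by metis
  have "chart_deriv (chart_at A p) (\<lambda>q. \<Sum>j<dim (UNIV::'e set). g q (Y q) (left_field (e j) q) *\<^sub>R e j) p
      (\<lambda>u. \<Sum>j<dim (UNIV::'e set). k' j u *\<^sub>R e j)"
    using k' unfolding chart_deriv_def o_def by (intro has_derivative_sum has_derivative_scaleR_left) 
  then show ?thesis by (intro that) (simp only: left_coord_expand[OF e])
qed

text \<open>Expanding in a left invariant orthonormal frame avoids differentiating an inverse.\<close>

lemma left_coord_smooth:
  assumes c: "c \<in> A"
  shows "smooth_on (snd c ` fst c) ((\<lambda>q. left_coord q (coord_field A c w q)) \<circ> chart_inv c)"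
proof -
  obtain e where e: "scalar_product.orthonormal ip e (dim (UNIV::'e set))"
    using scalar_product.orthonormal_exists[OF scalar_product] .
  obtain b :: "nat \<Rightarrow> 'e" where b: "onb b" using onb_exists[OF finite_dim] .
  let ?S = "snd c ` fst c" and ?i = "chart_inv c"
  have S: "open ?S" using open_chart_image[OF is_chart[OF c] open_UNIV] by simp
  have k: "smooth_on ?S (\<lambda>x. g (?i x) (coord_field A c w (?i x)) (coord_field A c (b i) (?i x)))" for i
    using metric c by (simp add: riemannian_metric_def o_def)
  have l: "smooth_on ?S (\<lambda>x. coord A c (?i x) (left_field (e j) (?i x)))" for j
    using left_field_smooth[OF c, of "e j"] by (simp add: o_def)
  have "smooth_on ?S (\<lambda>x. \<Sum>j<dim (UNIV::'e set). (\<Sum>i<dim (UNIV::'e set).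
      (coord A c (?i x) (left_field (e j) (?i x)) \<bullet> b i) *\<^sub>R
        g (?i x) (coord_field A c w (?i x)) (coord_field A c (b i) (?i x))) *\<^sub>R e j)"
    by (intro smooth_on_sum smooth_on_scaleR smooth_on_const S k
        smooth_on_bounded_linear[OF S bounded_linear_inner_left l])
  then show ?thesis
  proof (rule smooth_on_cong[OF S, rotated])
    fix x assume "x \<in> ?S"
    then have x: "?i x \<in> fst c" by (rule chart_inv_in)
    have "(\<Sum>i<dim (UNIV::'e set). (coord A c (?i x) (left_field v (?i x)) \<bullet> b i) *\<^sub>R
        g (?i x) (coord_field A c w (?i x)) (coord_field A c (b i) (?i x))) =
        g (?i x) (coord_field A c w (?i x)) (left_field v (?i x))" for v
      using onb_linear[OF b linear_metric_field[OF c x, of "coord_field A c w (?i x)"],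
          of "coord A c (?i x) (left_field v (?i x))"]
      by (simp add: coord_field_coord[OF c x])
    then show "(\<Sum>j<dim (UNIV::'e set). (\<Sum>i<dim (UNIV::'e set).
        (coord A c (?i x) (left_field (e j) (?i x)) \<bullet> b i) *\<^sub>R
          g (?i x) (coord_field A c w (?i x)) (coord_field A c (b i) (?i x))) *\<^sub>R e j) =
        ((\<lambda>q. left_coord q (coord_field A c w q)) \<circ> ?i) x"
      by (simp add: left_coord_expand[OF e])
  qed
qed

text \<open>The derivative of the left invariant fields and the Christoffel term combine into a
  Levi-Civita derivative. The left form of \<open>V\<close> is asked for on a neighbourhood
  \<open>W\<close> because in the curvature computation first derivatives are known in this form
  only on a chart domain.\<close>

lemma pullback_conn_left:
  assumes \<phi>: "manifold_map M A \<phi>"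
    and W: "open W" "p \<in> W" and V: "\<And>q. q \<in> W \<Longrightarrow> V q = left_field (\<omega> q) (\<phi> q)"
    and \<omega>: "chart_deriv (chart_at M p) \<omega> p \<omega>1"
  shows "pullback_conn M A g \<phi> X V p =
    left_field (\<omega>1 (X p) + conn (left_coord (\<phi> p) (tangent_map M A \<phi> p (X p))) (\<omega> p)) (\<phi> p)"
proof -
  interpret F: manifold_map M A \<phi> by (rule \<phi>)
  let ?c = "chart_at M p" and ?d = "chart_at A (\<phi> p)"
  let ?T = "tangent_map M A \<phi> p"
  note here = F.S.is_chart_at[of p] F.S.chart_at(2)[of p]
  have W': "open (\<phi> -` fst ?d)" "p \<in> \<phi> -` fst ?d"
    using F.continuous is_chart_at[of "\<phi> p"] chart_at[of "\<phi> p"]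
    by (auto simp: is_chart_def intro: open_vimage)
  have "chart_deriv ?c (\<lambda>q. coord A ?d (\<phi> q) (left_field (\<omega> q) (\<phi> q))) p
      (\<lambda>u. left_deriv ?d (\<phi> p) (?T u) (\<omega> p) + coord A ?d (\<phi> p) (left_field (\<omega>1 u) (\<phi> p)))"
  proof (rule chart_deriv_apply_linear[OF finite_dim here W' _ _ \<omega>])
    show "linear (\<lambda>v. coord A ?d (\<phi> q) (left_field v (\<phi> q)))" if "q \<in> \<phi> -` fst ?d" for q
      using that by (intro linear_coord_left_field chart_at) simp
    show "chart_deriv ?c (\<lambda>q. coord A ?d (\<phi> q) (left_field v (\<phi> q))) p (\<lambda>u. left_deriv ?d (\<phi> p) (?T u) v)" for v
      by (rule F.pullback_deriv[OF left_field_deriv[OF chart_at]])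
  qed
  then have "chart_deriv ?c (\<lambda>q. coord A ?d (\<phi> q) (V q)) p
      (\<lambda>u. left_deriv ?d (\<phi> p) (?T u) (\<omega> p) + left_field (\<omega>1 u) (\<phi> p))"
    unfolding coord_chart_at by (rule chart_deriv_cong[OF here W, rotated]) (simp add: V)
  then have "pullback_conn M A g \<phi> X V p = left_deriv ?d (\<phi> p) (?T (X p)) (\<omega> p) +
      left_field (\<omega>1 (X p)) (\<phi> p) + christoffel A g (\<phi> p) (?T (X p)) (V p)"
    unfolding pullback_conn_def by (simp add: chart_deriv_dir_deriv)
  \<comment> \<open>The direction is extended to a left invariant field; \<open>levi_civita\<close>
    reads its direction field only at the point.\<close>
  also have "\<dots> = left_field (\<omega>1 (X p)) (\<phi> p) +
      levi_civita A g (left_field (left_coord (\<phi> p) (?T (X p)))) (left_field (\<omega> p)) (\<phi> p)"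
    by (simp add: levi_civita_left_deriv left_field_left_coord V[OF W(2)])
  finally show ?thesis
    by (simp add: levi_civita_left_fields linear_add[OF linear_left_field])
qed

lemma manifold_map_id: "manifold_map A A (\<lambda>x. x)"
  using left_mult_map[of \<one>] by simp

text \<open>Viewed as the pull-back along the identity, the Levi-Civita connection gets its formula
  in left coordinates as a special case.\<close>

lemma levi_civita_pullback: "levi_civita A g X Y p = pullback_conn A A g (\<lambda>x. x) X Y p"
  by (simp add: levi_civita_def pullback_conn_def tangent_map_id[OF manifold_axioms])

lemma levi_civita_left:
  assumes "open W" "p \<in> W" "\<And>q. q \<in> W \<Longrightarrow> Y q = left_field (\<omega> q) q"
    and "chart_deriv (chart_at A p) \<omega> p \<omega>1"
  shows "levi_civita A g X Y p = left_field (\<omega>1 (X p) + conn (left_coord p (X p)) (\<omega> p)) p"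
  unfolding levi_civita_pullback
  by (subst pullback_conn_left[OF manifold_map_id assms]) (simp_all add: tangent_map_id[OF manifold_axioms])

lemma bounded_linear_conn: "bounded_linear (conn u)" "bounded_linear (\<lambda>u. conn u v)"
  by (intro linear_imp_bounded_linear finite_dim linear_conn linear_conn_left)+

text \<open>Coordinate fields commute but have non-constant left coordinates. The second derivatives
  of these are symmetric and cancel in the commutator of covariant derivatives; the antisymmetrised
  first derivatives form d\<theta> for the Maurer-Cartan form \<theta>, and its structure equation
  supplies the bracket term.\<close>

lemma curvature_left:
  "curvature A g p (left_field \<xi> p) (left_field \<eta> p) (left_field \<zeta> p) =
    left_field (conn \<xi> (conn \<eta> \<zeta>) - conn \<eta> (conn \<xi> \<zeta>) - conn (bracket \<xi> \<eta>) \<zeta>) p"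
proof -
  define c where "c = chart_at A p"
  have c: "c \<in> A" "p \<in> fst c" "is_chart c" "open (fst c)"
    using is_chart_at[of p] by (simp_all add: c_def chart_at is_chart_def)
  let ?S = "snd c ` fst c"
  have S: "open ?S" "snd c p \<in> ?S" using open_chart_image[OF c(3) open_UNIV] c(2) by auto
  define lc where "lc w q = left_coord q (coord_field A c w q)" for w q
  define f where "f w = lc w \<circ> chart_inv c" for w
  have f: "smooth_on ?S (f w)" for w
    unfolding f_def lc_def by (rule left_coord_smooth[OF c(1)])
  let ?D = "\<lambda>w q. frechet_derivative (f w) (at (snd c q))"
  have lcD: "chart_deriv c (lc w) q (?D w q)" if "q \<in> fst c" for q w
    unfolding f_def by (rule chart_deriv_smooth[OF f[unfolded f_def] that])
  have field: "coord_field A c w q = left_field (lc w q) q" for w q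
    by (simp add: lc_def left_field_left_coord)
  have lcp: "lc (left_field v p) p = v" for v
    by (simp add: lc_def c_def coord_field_chart_at left_coord_left_field)
  \<comment> \<open>Left coordinates of the covariant derivative of the coordinate field of
    \<open>w\<close> along that of \<open>v\<close>.\<close>
  define \<omega> where "\<omega> v w q = ?D w q v + conn (lc v q) (lc w q)" for v w q
  have LC: "levi_civita A g (coord_field A c v) (coord_field A c w) q = left_field (\<omega> v w q) q"
    if q: "q \<in> fst c" for v w q
    using levi_civita_left[OF open_UNIV UNIV_I field change_to_chart_at[OF lcD[OF q] c(1) q], of "coord_field A c v" w]
    by (simp add: \<omega>_def lc_def coord_coord_field[OF c(1) q])
  define H where "H w v u = frechet_derivative (\<lambda>x. frechet_derivative (f w) (at x) v) (at (snd c p)) u" for w v u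
  have \<omega>D: "chart_deriv c (\<omega> v w) p (\<lambda>u. H w v u + (conn (?D v p u) (lc w p) + conn (lc v p) (?D w p u)))" for v w
  proof -
    have "chart_deriv c (\<lambda>q. ?D w q v) p (H w v)"
    proof -
      have "((\<lambda>x. frechet_derivative (f w) (at x) v) has_derivative H w v) (at (snd c p))"
        using smooth_on_has_derivative[OF smooth_on_frechet[OF f] S(2)] by (simp add: H_def[abs_def])
      then show ?thesis unfolding chart_deriv_def
        by (rule has_derivative_transform_within_open[OF _ S]) (use c in \<open>auto simp: chart_inv_eq\<close>)
    qed
    moreover have "chart_deriv c (\<lambda>q. conn (lc v q) (lc w q)) p
        (\<lambda>u. conn (?D v p u) (lc w p) + conn (lc v p) (?D w p u))"
    proof (rule chart_deriv_apply_linear[OF finite_dim c(3,2) open_UNIV UNIV_I linear_conn _ lcD[OF c(2)]])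
      show "chart_deriv c (\<lambda>q. conn (lc v q) y) p (\<lambda>u. conn (?D v p u) y)" for y
        by (rule chart_deriv_compose[OF lcD[OF c(2)] _ c(3,2)])
           (rule bounded_linear_imp_has_derivative[OF bounded_linear_conn(2)])
    qed
    ultimately show ?thesis
      unfolding chart_deriv_def \<omega>_def o_def by (rule has_derivative_add)
  qed
  have LC2: "levi_civita A g (coord_field A c u) (levi_civita A g (coord_field A c v) (coord_field A c w)) p =
      left_field (H w v u + (conn (?D v p u) (lc w p) + conn (lc v p) (?D w p u)) + conn (lc u p) (\<omega> v w p)) p" for u v w
    using levi_civita_left[OF c(4) c(2) LC[where v = v and w = w] \<omega>D[unfolded c_def], of "coord_field A c u"]
    by (simp add: c_def coord_field_chart_at lc_def)
  \<comment> \<open>Vanishing at \<open>p\<close> is enough for the third curvature term, since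
    \<open>levi_civita\<close> depends on the direction field only through its value there.\<close>
  have flat: "lie_bracket A (coord_field A c u) (coord_field A c v) p = 0" for u v
  proof -
    have "chart_deriv c (\<lambda>q. coord A c q (coord_field A c w q)) p (\<lambda>u. 0)" for w
      by (rule chart_deriv_cong[OF c(3,2) open_UNIV UNIV_I _ chart_deriv_const])
         (simp add: coord_coord_field[OF c(1)])
    from chart_deriv_dir_deriv[OF this[unfolded c_def]] show ?thesis
      by (simp add: lie_bracket_def c_def)
  qed
  have LC0: "levi_civita A g (lie_bracket A (coord_field A c u) (coord_field A c v)) (coord_field A c w) p = 0" for u v w
    using levi_civita_left[OF open_UNIV UNIV_I field lcD[OF c(2), unfolded c_def], folded c_def,
        of "lie_bracket A (coord_field A c u) (coord_field A c v)" w]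
    by (simp add: flat linear_0[OF chart_deriv_linear[OF lcD[OF c(2)]]] linear_0[OF linear_left_coord]
        linear_0[OF linear_conn_left] linear_0[OF linear_left_field])
  \<comment> \<open>Reassembling the coordinate field from \<open>lc v\<close> gives the constant
    \<open>v\<close> in coordinates; the derivative of this identity expresses that of
    \<open>lc v\<close> by \<open>left_deriv\<close>.\<close>
  have DL: "left_field (?D v p u) p = - left_deriv c p u (lc v p)" for u v
  proof -
    have "chart_deriv c (\<lambda>q. coord A c q (left_field (lc v q) q)) p
        (\<lambda>u. left_deriv c p u (lc v p) + coord A c p (left_field (?D v p u) p))"
      by (rule chart_deriv_apply_linear[OF finite_dim c(3,2) open_UNIV UNIV_I
            linear_coord_left_field[OF c(1)] left_field_deriv[OF c(1,2)] lcD[OF c(2)]])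
    moreover have "chart_deriv c (\<lambda>q. coord A c q (left_field (lc v q) q)) p (\<lambda>u. 0)"
      by (rule chart_deriv_cong[OF c(3,2) open_UNIV UNIV_I _ chart_deriv_const])
         (simp add: coord_coord_field[OF c(1)] field[symmetric])
    ultimately have "(\<lambda>u. left_deriv c p u (lc v p) + coord A c p (left_field (?D v p u) p)) = (\<lambda>u. 0)"
      by (rule chart_deriv_unique)
    from fun_cong[OF this, of u] show ?thesis
      by (simp add: c_def coord_chart_at add_eq_0_iff)
  qed
  let ?u = "left_field \<xi> p" and ?v = "left_field \<eta> p" and ?w = "left_field \<zeta> p"
  have "left_field (?D ?v p ?u - ?D ?u p ?v) p = left_field (- bracket \<xi> \<eta>) p"
    using bracket_left_deriv[of \<xi> \<eta> p, folded c_def]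
    by (simp add: linear_diff[OF linear_left_field] linear_neg[OF linear_left_field] DL lcp bracket_left_fields)
  \<comment> \<open>The Maurer-Cartan equation d\<theta>(u, v) = - [\<theta>(u), \<theta>(v)] at
    \<open>p\<close>.\<close>
  then have br: "?D ?v p ?u - ?D ?u p ?v = - bracket \<xi> \<eta>"
    by (metis left_coord_left_field)
  have sym: "H w v u = H w u v" for u v w
    unfolding H_def by (rule second_derivative_symmetric[OF S f])
  have "curvature A g p ?u ?v ?w =
      left_field (H ?w ?v ?u + (conn (?D ?v p ?u) \<zeta> + conn \<eta> (?D ?w p ?u)) + conn \<xi> (?D ?w p ?v + conn \<eta> \<zeta>)) p -
      left_field (H ?w ?u ?v + (conn (?D ?u p ?v) \<zeta> + conn \<xi> (?D ?w p ?v)) + conn \<eta> (?D ?w p ?u + conn \<xi> \<zeta>)) p"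
    unfolding curvature_def Let_def c_def[symmetric] LC2 LC0 by (simp add: lcp \<omega>_def)
  also have "\<dots> = left_field (conn (?D ?v p ?u - ?D ?u p ?v) \<zeta> + conn \<xi> (conn \<eta> \<zeta>) - conn \<eta> (conn \<xi> \<zeta>)) p"
    unfolding linear_diff[OF linear_left_field, symmetric] sym[of ?w ?u ?v]
    by (simp add: linear_add[OF linear_conn] linear_diff[OF linear_conn_left] algebra_simps)
  finally show ?thesis
    unfolding br by (simp add: linear_neg[OF linear_conn_left] algebra_simps)
qed

text \<open>Both sides are mixed second derivatives of multiplication at the pair of identities, in
  the directions \<open>(x, 0)\<close> and \<open>(0, z)\<close>, taken in opposite orders.\<close>

lemma right_field_deriv:
  "chart_deriv (chart_at A \<one>) (\<lambda>q. coord A (chart_at A \<one>) q (tangent_map A A (\<lambda>y. y \<otimes> q) \<one> x)) \<one>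
     (\<lambda>z. left_deriv (chart_at A \<one>) \<one> x z)"
proof -
  define c where "c = chart_at A \<one>"
  have c: "c \<in> A" "\<one> \<in> fst c" "is_chart c" by (simp_all add: c_def chart_at is_chart_at)
  let ?S = "snd c ` fst c" and ?m = "mult_local c c c" and ?o = "(snd c \<one>, snd c \<one>)"
  have S: "open ?S" "snd c \<one> \<in> ?S" using open_chart_image[OF c(3) open_UNIV] c(2) by auto
  have dom: "open (mult_dom c c c)" "?o \<in> mult_dom c c c"
    using c by (auto intro!: mult_dom_open mult_domI simp: chart_inv_eq)
  note m = mult_local_smooth[OF c(1) c(1) c(1)]
  note D = smooth_on_has_derivative[OF smooth_on_frechet[OF m] dom(2)]
  let ?H = "\<lambda>a b. frechet_derivative (\<lambda>w. frechet_derivative ?m (at w) a) (at ?o) b"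
  have "((\<lambda>y. (snd c \<one>, y)) has_derivative (\<lambda>z. (0, z))) (at (snd c \<one>))"
    by (auto intro!: derivative_eq_intros)
  from has_derivative_compose[OF this D[of "(x, 0)"]]
  have right: "chart_deriv c (\<lambda>q. coord A c q (tangent_map A A (\<lambda>y. y \<otimes> q) \<one> x)) \<one> (\<lambda>z. ?H (x, 0) (0, z))"
    unfolding chart_deriv_def
    by (rule has_derivative_transform_within_open[OF _ S])
       (auto simp: coord_right_field[folded c_def] chart_inv_eq[OF c(3)])
  have left: "left_deriv c \<one> x z = ?H (0, z) (x, 0)" for z
  proof -
    have "((\<lambda>y. (y, snd c \<one>)) has_derivative (\<lambda>z. (z, 0))) (at (snd c \<one>))"
      by (auto intro!: derivative_eq_intros)
    from has_derivative_compose[OF this D[of "(0, z)"]]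
    have "chart_deriv c (\<lambda>q. coord A c q (left_field z q)) \<one> (\<lambda>x. ?H (0, z) (x, 0))"
      unfolding chart_deriv_def
      by (rule has_derivative_transform_within_open[OF _ S])
         (auto simp: coord_left_field[OF c(1), folded c_def] chart_inv_eq[OF c(3)])
    from fun_cong[OF chart_deriv_unique[OF left_field_deriv[OF c(1,2)] this], of x] show ?thesis .
  qed
  have "?H (x, 0) (0, z) = ?H (0, z) (x, 0)" for z
    by (rule second_derivative_symmetric[OF dom m])
  with right show ?thesis unfolding c_def[symmetric] left by simp
qed

text \<open>Both \<open>g(L\<^sub>q x, L\<^sub>q y)\<close> and \<open>g(R\<^sub>q x, R\<^sub>q y)\<close> are constant in \<open>q\<close>. Since the derivative of
  \<open>R\<^sub>q x\<close> at \<open>\<one>\<close> in direction \<open>z\<close> is that of \<open>L\<^sub>q z\<close> in direction \<open>x\<close>, subtracting the two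
  differentiated equations leaves only brackets. This avoids the exponential map.\<close>

lemma bi_invariant_bracket:
  assumes "bi_invariant G A g"
  shows "ip (bracket z x) y = - ip x (bracket z y)"
proof -
  let ?c = "chart_at A \<one>"
  define R where "R x q = tangent_map A A (\<lambda>y. y \<otimes> q) \<one> x" for x q
  have R: "g q (R x q) (R y q) = ip x y" for q x y
    using assms unfolding bi_invariant_def right_invariant_def R_def by (metis carrier_UNIV l_one)
  have R1: "R x \<one> = x" for x
    by (simp add: R_def tangent_map_id[OF manifold_axioms])
  have zero: "k' = (\<lambda>u. 0)" if "chart_deriv ?c k \<one> k'" "\<And>q. k q = r" for k k' and r :: real
  proof -
    have "k = (\<lambda>q. r)" using that(2) by (rule ext)
    then have "chart_deriv ?c k \<one> (\<lambda>u. 0)" by (metis chart_deriv_const)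
    with that(1) show ?thesis by (rule chart_deriv_unique)
  qed
  have "metric_deriv \<one> z x y + ip x (left_deriv ?c \<one> z y) + ip (left_deriv ?c \<one> z x) y = 0"
    using fun_cong[OF zero[OF metric_product_rule[OF left_field_deriv[OF chart_at] left_field_deriv[OF chart_at]]
      metric_left_fields], of z x y] by (simp add: left_field_one)
  moreover have "metric_deriv \<one> z x y + ip x (left_deriv ?c \<one> y z) + ip (left_deriv ?c \<one> x z) y = 0"
    using fun_cong[OF zero[OF metric_product_rule[OF right_field_deriv[folded R_def] right_field_deriv[folded R_def]]
      R], of z] by (simp add: R1)
  ultimately show ?thesis by (simp add: bracket_eq metric_left metric_right)
qed

lemma bi_invariant_conn:
  assumes "bi_invariant G A g"
  shows "conn u v = (1 / 2) *\<^sub>R bracket u v"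
proof (rule scalar_product.nondegenerate[OF scalar_product])
  fix w
  have "ip v (bracket w u) + ip u (bracket w v) = 0"
    using bi_invariant_bracket[OF assms, of w u v] by (simp add: metric_commute)
  then show "ip (conn u v) w = ip ((1 / 2) *\<^sub>R bracket u v) w"
    using koszul_conn[of u v w] by (simp add: metric_left)
qed

end

section \<open>Homomorphisms\<close>

context riemannian_lie_group_loc
begin

lemmas ip_eqI = scalar_product.nondegenerate[OF scalar_product[of \<one>]]

lemma bracket_self: "bracket u u = 0"
  by (simp add: bracket_eq)

text \<open>Guarantees that the \<open>SOME\<close> in \<open>tension\<close> and
  \<open>bitension\<close> selects a frame; a left invariant one, defined on the whole group, is the
  witness.\<close>

lemma orthonormal_frame_exists: "\<exists>E. orthonormal_frame_near A g p E"
proof -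
  obtain e where e: "scalar_product.orthonormal ip e (dim (UNIV::'e set))"
    using scalar_product.orthonormal_exists[OF scalar_product] .
  then have "orthonormal_frame_near A g p (\<lambda>i. left_field (e i))"
    unfolding orthonormal_frame_near_def smooth_field_on_def
    by (intro exI[of _ UNIV])
       (auto simp: metric_left_fields left_field_smooth scalar_product.orthonormal_def[OF scalar_product])
  then show ?thesis by blast
qed

text \<open>Isolates what is used of a frame given only by \<open>SOME\<close>; the unknown
  derivative \<epsilon> cancels in the fields built from it.\<close>

lemma orthonormal_frame_coords:
  assumes "orthonormal_frame_near A g p E"
  shows "scalar_product.orthonormal ip (\<lambda>i. left_coord p (E i p)) (dim (UNIV::'e set))"
    and "\<And>i. i < dim (UNIV::'e set) \<Longrightarrow> \<exists>\<epsilon>. chart_deriv (chart_at A p) (\<lambda>q. left_coord q (E i q)) p \<epsilon>"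
proof -
  obtain W where W: "p \<in> W" "\<And>i. i < dim (UNIV::'e set) \<Longrightarrow> smooth_field_on A W (E i)"
    and on: "\<And>i j. i < dim (UNIV::'e set) \<Longrightarrow> j < dim (UNIV::'e set) \<Longrightarrow> g p (E i p) (E j p) = (if i = j then 1 else 0)"
    using assms unfolding orthonormal_frame_near_def by blast
  show "scalar_product.orthonormal ip (\<lambda>i. left_coord p (E i p)) (dim (UNIV::'e set))"
    unfolding scalar_product.orthonormal_def[OF scalar_product] metric_left_fields[of p, symmetric] left_field_left_coord
    using on by blast
  fix i assume "i < dim (UNIV::'e set)"
  then have "smooth_on (snd (chart_at A p) ` (fst (chart_at A p) \<inter> W))
      ((\<lambda>q. coord A (chart_at A p) q (E i q)) \<circ> chart_inv (chart_at A p))"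
    using W(2) chart_at(1) by (simp add: smooth_field_on_def)
  from chart_deriv_smooth[OF this] have "\<exists>Y1. chart_deriv (chart_at A p) (\<lambda>q. coord A (chart_at A p) q (E i q)) p Y1"
    using W(1) chart_at(2) by blast
  then show "\<exists>\<epsilon>. chart_deriv (chart_at A p) (\<lambda>q. left_coord q (E i q)) p \<epsilon>"
    using left_coord_differentiable by metis
qed

text \<open>The right-hand side does not mention \<open>e\<close>, so the sum is the same vector for
  all orthonormal bases; this matters because frames at different points are selected independently.
  In the Koszul formula the bracket of \<open>u\<close> with itself vanishes and the other two terms
  agree.\<close>

lemma conn_trace:
  assumes e: "scalar_product.orthonormal ip e (dim (UNIV::'e set))"
  shows "ip (\<Sum>i<dim (UNIV::'e set). conn (e i) (e i)) w = lin_trace (bracket w)"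
proof -
  have "ip (conn u u) w = ip (bracket w u) u" for u
    using koszul_conn[of u u w] by (simp add: bracket_self metric_left metric_commute)
  then show ?thesis
    by (simp add: metric_left scalar_product.lin_trace_orthonormal[OF scalar_product e linear_bracket])
qed

end

section \<open>The differential of a homomorphism and its second fundamental form\<close>

locale riemannian_lie_group_hom =
  S: riemannian_lie_group_loc G A g + T: riemannian_lie_group_loc H B h
  for G :: "'a::{t2_space,second_countable_topology} monoid"
    and A :: "('a, 'e::real_inner) chart set"
    and g :: "'a \<Rightarrow> 'e \<Rightarrow> 'e \<Rightarrow> real"
    and H :: "'b::{t2_space,second_countable_topology} monoid"
    and B :: "('b, 'f::real_inner) chart set"
    and h :: "'b \<Rightarrow> 'f \<Rightarrow> 'f \<Rightarrow> real" +
  fixes \<phi> :: "'a \<Rightarrow> 'b"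
  assumes hom: "lie_group_hom G A H B \<phi>"

sublocale riemannian_lie_group_hom \<subseteq> manifold_map A B \<phi>
  using hom by unfold_locales (simp add: lie_group_hom_def)

context riemannian_lie_group_hom
begin

lemma map_mult: "\<phi> (x \<otimes>\<^bsub>G\<^esub> y) = \<phi> x \<otimes>\<^bsub>H\<^esub> \<phi> y"
  using hom by (simp add: lie_group_hom_def hom_def)

lemma map_one: "\<phi> \<one>\<^bsub>G\<^esub> = \<one>\<^bsub>H\<^esub>"
  using map_mult[of "\<one>\<^bsub>G\<^esub>" "\<one>\<^bsub>G\<^esub>"] T.l_cancel_one[of "\<phi> \<one>\<^bsub>G\<^esub>" "\<phi> \<one>\<^bsub>G\<^esub>"] by simp

definition F :: "'e \<Rightarrow> 'f" where
  "F = tangent_map A B \<phi> \<one>\<^bsub>G\<^esub>"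

lemma linear_F: "linear F"
  unfolding F_def by (rule linear_tangent_map)

lemma manifold_map_\<phi>: "manifold_map A B \<phi>"
  by unfold_locales

text \<open>A homomorphism intertwines left translation by \<open>q\<close> with that by
  \<open>\<phi> q\<close>; the chain rule at the identity does the rest.\<close>

lemma tangent_left_field: "tangent_map A B \<phi> q (S.left_field v q) = T.left_field (F v) (\<phi> q)"
proof -
  have "\<phi> \<circ> (\<lambda>y. q \<otimes>\<^bsub>G\<^esub> y) = (\<lambda>y. \<phi> q \<otimes>\<^bsub>H\<^esub> y) \<circ> \<phi>" by (simp add: fun_eq_iff map_mult)
  then show ?thesis
    using tangent_map_compose[OF S.left_mult_map manifold_map_\<phi>, of q "\<one>\<^bsub>G\<^esub>" v]
      tangent_map_compose[OF manifold_map_\<phi> T.left_mult_map, of "\<phi> q" "\<one>\<^bsub>G\<^esub>" v]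
    by (simp add: left_inv_field_def F_def map_one)
qed

lemma tangent_eq: "tangent_map A B \<phi> q u = T.left_field (F (S.left_coord q u)) (\<phi> q)"
  using tangent_left_field[of q "S.left_coord q u"] by (simp add: S.left_field_left_coord)

lemma left_coord_tangent: "T.left_coord (\<phi> q) (tangent_map A B \<phi> q u) = F (S.left_coord q u)"
  by (simp add: tangent_eq T.left_coord_left_field)

lemma F_bracket: "F (S.bracket u v) = T.bracket (F u) (F v)"
proof -
  have "tangent_map A B \<phi> \<one>\<^bsub>G\<^esub> (lie_bracket A (S.left_field u) (S.left_field v) \<one>\<^bsub>G\<^esub>) =
      lie_bracket B (T.left_field (F u)) (T.left_field (F v)) (\<phi> \<one>\<^bsub>G\<^esub>)"
    by (rule related_bracket[OF tangent_left_field tangent_left_field])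
       (rule S.left_field_deriv[OF S.chart_at] T.left_field_deriv[OF T.chart_at])+
  then show ?thesis by (simp add: ad_def F_def map_one)
qed

lemma F_deriv:
  assumes "chart_deriv (chart_at A p) \<epsilon> p \<epsilon>1"
  shows "chart_deriv (chart_at A p) (\<lambda>q. F (\<epsilon> q)) p (\<lambda>u. F (\<epsilon>1 u))"
  by (rule chart_deriv_compose[OF assms _ S.is_chart_at S.chart_at(2)])
     (rule bounded_linear_imp_has_derivative[OF linear_imp_bounded_linear[OF S.finite_dim linear_F]])

text \<open>The derivative \<epsilon> of the left coordinates of \<open>Y\<close> appears as
  \<open>F (\<epsilon> (X p))\<close> both in the pull-back term and in the image of the Levi-Civita
  term, so it drops out.\<close>

lemma second_fund_left:
  assumes "chart_deriv (chart_at A p) (\<lambda>q. S.left_coord q (Y q)) p \<epsilon>"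
  shows "second_fund A g B h \<phi> X Y p = T.left_field
    (T.conn (F (S.left_coord p (X p))) (F (S.left_coord p (Y p))) -
      F (S.conn (S.left_coord p (X p)) (S.left_coord p (Y p)))) (\<phi> p)"
proof -
  have "pullback_conn A B h \<phi> X (\<lambda>q. tangent_map A B \<phi> q (Y q)) p = T.left_field
      (F (\<epsilon> (X p)) + T.conn (F (S.left_coord p (X p))) (F (S.left_coord p (Y p)))) (\<phi> p)"
    using T.pullback_conn_left[OF manifold_map_\<phi> open_UNIV UNIV_I tangent_eq F_deriv[OF assms]]
    by (simp add: left_coord_tangent)
  moreover have "levi_civita A g X Y p =
      S.left_field (\<epsilon> (X p) + S.conn (S.left_coord p (X p)) (S.left_coord p (Y p))) p"
    by (rule S.levi_civita_left[OF open_UNIV UNIV_I _ assms]) (simp add: S.left_field_left_coord)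
  ultimately show ?thesis
    by (simp add: second_fund_def tangent_left_field linear_add[OF linear_F]
        flip: linear_diff[OF T.linear_left_field])
qed

text \<open>The basis \<open>e\<close> is obtained for each \<open>p\<close> separately, as the left
  coordinates there of the selected frame.\<close>

lemma tension_left:
  obtains e where "scalar_product.orthonormal S.ip e (dim (UNIV::'e set))"
    and "tension A g B h \<phi> p = T.left_field
      (\<Sum>i<dim (UNIV::'e set). T.conn (F (e i)) (F (e i)) - F (S.conn (e i) (e i))) (\<phi> p)"
proof -
  define E where "E = (SOME E. orthonormal_frame_near A g p E)"
  have "orthonormal_frame_near A g p E"
    unfolding E_def by (rule someI_ex[OF S.orthonormal_frame_exists])
  note fr = S.orthonormal_frame_coords[OF this]
  have "tension A g B h \<phi> p = (\<Sum>i<dim (UNIV::'e set). second_fund A g B h \<phi> (E i) (E i) p)"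
    by (simp add: tension_def E_def Let_def)
  also have "\<dots> = (\<Sum>i<dim (UNIV::'e set). T.left_field
      (T.conn (F (S.left_coord p (E i p))) (F (S.left_coord p (E i p))) -
        F (S.conn (S.left_coord p (E i p)) (S.left_coord p (E i p)))) (\<phi> p))"
  proof (rule sum.cong[OF refl])
    fix i assume "i \<in> {..<dim (UNIV::'e set)}"
    then obtain \<epsilon> where "chart_deriv (chart_at A p) (\<lambda>q. S.left_coord q (E i q)) p \<epsilon>"
      using fr(2)[of i] by auto
    then show "second_fund A g B h \<phi> (E i) (E i) p = T.left_field
      (T.conn (F (S.left_coord p (E i p))) (F (S.left_coord p (E i p))) -
        F (S.conn (S.left_coord p (E i p)) (S.left_coord p (E i p)))) (\<phi> p)"
      by (rule second_fund_left)
  qed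
  finally show ?thesis
    by (intro that[OF fr(1)]) (simp add: linear_sum[OF T.linear_left_field])
qed

lemma harmonic_submersion:
  assumes G: "bi_invariant G A g" and sub: "submersion A B \<phi>"
  shows "harmonic A g B h \<phi>"
  unfolding harmonic_def
proof
  fix p
  let ?n = "dim (UNIV::'e set)"
  obtain e where e: "scalar_product.orthonormal S.ip e ?n"
    and \<tau>: "tension A g B h \<phi> p = T.left_field
      (\<Sum>i<?n. T.conn (F (e i)) (F (e i)) - F (S.conn (e i) (e i))) (\<phi> p)"
    by (rule tension_left)
  have "(\<Sum>i<?n. T.conn (F (e i)) (F (e i))) = 0"
  proof (rule T.ip_eqI)
    fix w
    \<comment> \<open>Surjectivity is used at the identity: every test vector lies in the image of
      \<open>F\<close>, so brackets with it can be computed in the Lie algebra of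
      \<open>G\<close>.\<close>
    obtain z where z: "w = F z" using sub unfolding submersion_def F_def by (meson surj_def)
    let ?a = "\<lambda>i j. S.ip (S.bracket z (e i)) (e j)" and ?s = "\<lambda>i j. T.ip (F (e i)) (F (e j))"
    have conn: "T.ip (T.conn (F u) (F u)) (F z) = T.ip (F u) (F (S.bracket z u))" for u
      using T.koszul_conn[of "F u" "F u" "F z"] by (simp add: T.bracket_self T.metric_left F_bracket)
    have "T.ip (F (e i)) (F (S.bracket z (e i))) = (\<Sum>j<?n. ?a i j * ?s i j)" for i
    proof -
      have "F (S.bracket z (e i)) = F (\<Sum>j<?n. ?a i j *\<^sub>R e j)"
        by (rule arg_cong[OF scalar_product.orthonormal_expand[OF S.scalar_product e]])
      then show ?thesis
        by (simp add: linear_sum[OF linear_F] linear_cmul[OF linear_F] T.metric_right)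
    qed
    note expand = this
    have anti: "?a i j * ?s i j = - (?a j i * ?s j i)" for i j
    proof -
      have "?a i j = - ?a j i"
        using S.bi_invariant_bracket[OF G, of z "e i" "e j"] S.metric_commute[of _ "e i" "S.bracket z (e j)"]
        by (rule trans[OF _ arg_cong[where f = uminus]])
      moreover have "?s i j = ?s j i" by (rule T.metric_commute)
      ultimately show ?thesis by (simp only: mult_minus_left)
    qed
    \<comment> \<open>Exchanging the summation indices turns this sum of an antisymmetric against a
      symmetric array into its own negative.\<close>
    from expand have sum: "T.ip (\<Sum>i<?n. T.conn (F (e i)) (F (e i))) w = (\<Sum>i<?n. \<Sum>j<?n. ?a i j * ?s i j)"
      by (simp add: z T.metric_left conn)
    also have "\<dots> = (\<Sum>j<?n. \<Sum>i<?n. ?a i j * ?s i j)" by (rule sum.swap)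
    also have "\<dots> = (\<Sum>j<?n. \<Sum>i<?n. - (?a j i * ?s j i))"
      by (intro sum.cong refl anti)
    also have "\<dots> = - (\<Sum>i<?n. \<Sum>j<?n. ?a i j * ?s i j)" by (simp add: sum_negf)
    finally show "T.ip (\<Sum>i<?n. T.conn (F (e i)) (F (e i))) w = T.ip 0 w"
      using sum by (simp add: T.metric_left)
  qed
  then show "tension A g B h \<phi> p = 0"
    by (simp add: \<tau> S.bi_invariant_conn[OF G] S.bracket_self linear_0[OF linear_F] linear_0[OF T.linear_left_field])
qed

text \<open>The basis from \<open>tension_left\<close> varies with \<open>p\<close>, but by
  \<open>conn_trace\<close> it always yields the same \<open>U\<close>. So the tension field has
  constant left coordinates, the form in which the bitension field can differentiate it.\<close>

lemma tension_bi_invariant: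
  assumes H: "bi_invariant H B h"
  obtains U where "\<And>w. S.ip U w = lin_trace (S.bracket w)"
    and "\<And>p. tension A g B h \<phi> p = T.left_field (- F U) (\<phi> p)"
proof -
  let ?n = "dim (UNIV::'e set)"
  obtain e0 where e0: "scalar_product.orthonormal S.ip e0 ?n"
    by (rule scalar_product.orthonormal_exists[OF S.scalar_product])
  define U where "U = (\<Sum>i<?n. S.conn (e0 i) (e0 i))"
  have U: "S.ip U w = lin_trace (S.bracket w)" for w
    unfolding U_def by (rule S.conn_trace[OF e0])
  have "tension A g B h \<phi> p = T.left_field (- F U) (\<phi> p)" for p
  proof -
    obtain e where e: "scalar_product.orthonormal S.ip e ?n"
      and \<tau>: "tension A g B h \<phi> p = T.left_field
        (\<Sum>i<?n. T.conn (F (e i)) (F (e i)) - F (S.conn (e i) (e i))) (\<phi> p)"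
      by (rule tension_left)
    have "(\<Sum>i<?n. S.conn (e i) (e i)) = U"
      by (rule S.ip_eqI) (simp only: U S.conn_trace[OF e])
    then show ?thesis
      by (simp add: \<tau> T.bi_invariant_conn[OF H] T.bracket_self sum_negf flip: linear_sum[OF linear_F])
  qed
  with U show ?thesis by (rule that)
qed

lemma harmonic_unimodular:
  assumes "bi_invariant H B h" "unimodular G A"
  shows "harmonic A g B h \<phi>"
proof -
  obtain U where U: "\<And>w. S.ip U w = lin_trace (S.bracket w)"
    and \<tau>: "\<And>p. tension A g B h \<phi> p = T.left_field (- F U) (\<phi> p)"
    using tension_bi_invariant[OF assms(1)] by metis
  have "U = 0"
    by (rule S.ip_eqI)
       (use assms(2) in \<open>simp add: U unimodular_def S.metric_left\<close>)
  then show ?thesis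
    by (simp add: harmonic_def \<tau> linear_0[OF linear_F] linear_0[OF T.linear_left_field])
qed

lemma biharmonic_bi_invariant:
  assumes H: "bi_invariant H B h"
  shows "biharmonic A g B h \<phi>"
  unfolding biharmonic_def
proof
  fix p
  let ?n = "dim (UNIV::'e set)"
  obtain U where U: "\<And>w. S.ip U w = lin_trace (S.bracket w)"
    and \<tau>: "\<And>p. tension A g B h \<phi> p = T.left_field (- F U) (\<phi> p)"
    using tension_bi_invariant[OF H] by metis
  let ?t = "- F U"
  note conn = T.bi_invariant_conn[OF H]
  define E where "E = (SOME E. orthonormal_frame_near A g p E)"
  have "orthonormal_frame_near A g p E"
    unfolding E_def by (rule someI_ex[OF S.orthonormal_frame_exists])
  note fr = S.orthonormal_frame_coords[OF this]
  define e where "e i = S.left_coord p (E i p)" for i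
  \<comment> \<open>The left coordinates of the tension field are constant, so only the algebraic
    term of the pull-back connection remains.\<close>
  have pc: "pullback_conn A B h \<phi> X (tension A g B h \<phi>) q =
      T.left_field (T.conn (F (S.left_coord q (X q))) ?t) (\<phi> q)" for X q
    using T.pullback_conn_left[OF manifold_map_\<phi> open_UNIV UNIV_I \<tau> chart_deriv_const, where p = q and X = X]
    by (simp add: left_coord_tangent)
  \<comment> \<open>The derivative \<epsilon> of the frame cancels between the two terms of
    \<open>pullback_conn2\<close>; the surviving part comes from N(e_i, e_i) in the Levi-Civita
    derivative of the frame.\<close>
  have summand: "pullback_conn2 A g B h \<phi> (E i) (E i) (tension A g B h \<phi>) p +
      curvature B h (\<phi> p) (tension A g B h \<phi> p) (tangent_map A B \<phi> p (E i p)) (tangent_map A B \<phi> p (E i p)) =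
      T.left_field (- T.conn (F (S.conn (e i) (e i))) ?t) (\<phi> p)" if i: "i < ?n" for i
  proof -
    obtain \<epsilon> where \<epsilon>: "chart_deriv (chart_at A p) (\<lambda>q. S.left_coord q (E i q)) p \<epsilon>"
      using fr(2)[OF i] by blast
    have "chart_deriv (chart_at A p) (\<lambda>q. T.conn (F (S.left_coord q (E i q))) ?t) p (\<lambda>u. T.conn (F (\<epsilon> u)) ?t)"
      by (rule chart_deriv_compose[OF F_deriv[OF \<epsilon>] _ S.is_chart_at S.chart_at(2)])
         (rule bounded_linear_imp_has_derivative[OF T.bounded_linear_conn(2)])
    from T.pullback_conn_left[OF manifold_map_\<phi> open_UNIV UNIV_I pc[where X = "E i"] this, where X = "E i"]
    have 1: "pullback_conn A B h \<phi> (E i) (pullback_conn A B h \<phi> (E i) (tension A g B h \<phi>)) p =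
        T.left_field (T.conn (F (\<epsilon> (E i p))) ?t + T.conn (F (e i)) (T.conn (F (e i)) ?t)) (\<phi> p)"
      by (simp add: left_coord_tangent e_def)
    have "levi_civita A g (E i) (E i) p = S.left_field (\<epsilon> (E i p) + S.conn (e i) (e i)) p"
      unfolding e_def by (rule S.levi_civita_left[OF open_UNIV UNIV_I _ \<epsilon>]) (simp add: S.left_field_left_coord)
    then have 2: "pullback_conn A B h \<phi> (levi_civita A g (E i) (E i)) (tension A g B h \<phi>) p =
        T.left_field (T.conn (F (\<epsilon> (E i p))) ?t + T.conn (F (S.conn (e i) (e i))) ?t) (\<phi> p)"
      unfolding pc by (simp add: S.left_coord_left_field linear_add[OF linear_F] linear_add[OF T.linear_conn_left])
    let ?x = "F (e i)"
    have 3: "curvature B h (\<phi> p) (tension A g B h \<phi> p) (tangent_map A B \<phi> p (E i p)) (tangent_map A B \<phi> p (E i p)) =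
        T.left_field (T.conn ?t (T.conn ?x ?x) - T.conn ?x (T.conn ?t ?x) - T.conn (T.bracket ?t ?x) ?x) (\<phi> p)"
      unfolding \<tau> tangent_eq e_def[symmetric] by (rule T.curvature_left)
    \<comment> \<open>With N = [., .] / 2 the coefficients of [x, [x, t]] are 1/4 and 1/4 from the
      iterated products and -1/2 from the bracket term.\<close>
    have "T.conn x (T.conn x t) + (T.conn t (T.conn x x) - T.conn x (T.conn t x) - T.conn (T.bracket t x) x) = 0" for x t
    proof -
      have swap: "T.conn x (T.bracket t x) = - T.conn x (T.bracket x t)"
        "T.conn (T.bracket t x) x = T.conn x (T.bracket x t)"
        using T.bracket_commute[of t x] T.bracket_commute[of "T.bracket t x" x]
        by (simp_all add: conn linear_neg[OF T.linear_bracket])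
      have c: "T.conn x (T.conn a b) = (1 / 2) *\<^sub>R T.conn x (T.bracket a b)" for a b
        by (simp only: conn[of a b] linear_cmul[OF T.linear_conn])
      have "T.conn x x = 0" by (simp add: conn T.bracket_self)
      then have "T.conn x (T.conn x t) + (T.conn t (T.conn x x) - T.conn x (T.conn t x) - T.conn (T.bracket t x) x) =
          (1 / 2) *\<^sub>R T.conn x (T.bracket x t) + (1 / 2) *\<^sub>R T.conn x (T.bracket x t) - T.conn x (T.bracket x t)"
        by (simp only: c swap) (simp add: linear_0[OF T.linear_conn])
      also have "\<dots> = 0" by (simp flip: scaleR_add_left)
      finally show ?thesis .
    qed
    from this[of ?x ?t] show ?thesis
      unfolding pullback_conn2_def 1 2 3 linear_diff[OF T.linear_left_field, symmetric]
        linear_add[OF T.linear_left_field, symmetric]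
      by (intro arg_cong[where f = "\<lambda>v. T.left_field v (\<phi> p)"]) (simp add: algebra_simps)
  qed
  \<comment> \<open>The frame at \<open>p\<close> gives the same \<open>U\<close> as the tension
    field, again because the trace form determines the sum.\<close>
  have "(\<Sum>i<?n. S.conn (e i) (e i)) = U"
    by (rule S.ip_eqI)
       (simp only: U S.conn_trace[OF fr(1)[folded e_def]])
  then have "(\<Sum>i<?n. - T.conn (F (S.conn (e i) (e i))) ?t) = - T.conn (F U) ?t"
    by (simp add: sum_negf flip: linear_sum[OF T.linear_conn_left] linear_sum[OF linear_F])
  also have "\<dots> = 0"
    by (simp add: conn linear_neg[OF T.linear_bracket] T.bracket_self)
  finally have "(\<Sum>i<?n. - T.conn (F (S.conn (e i) (e i))) ?t) = 0" .
  then have "(\<Sum>i<?n. pullback_conn2 A g B h \<phi> (E i) (E i) (tension A g B h \<phi>) p +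
      curvature B h (\<phi> p) (tension A g B h \<phi> p) (tangent_map A B \<phi> p (E i p)) (tangent_map A B \<phi> p (E i p))) = 0"
    using summand by (simp add: linear_0[OF T.linear_left_field] flip: linear_sum[OF T.linear_left_field])
  then show "bitension A g B h \<phi> p = 0"
    by (simp add: bitension_def Let_def E_def)
qed

end

theorem proposition2p5:
  fixes G :: "'a::{t2_space,second_countable_topology} monoid"
    and A :: "('a, 'e::real_inner) chart set"
    and g :: "'a \<Rightarrow> 'e \<Rightarrow> 'e \<Rightarrow> real"
    and H :: "'b::{t2_space,second_countable_topology} monoid"
    and B :: "('b, 'f::real_inner) chart set"
    and h :: "'b \<Rightarrow> 'f \<Rightarrow> 'f \<Rightarrow> real"
    and \<phi> :: "'a \<Rightarrow> 'b"
  assumes "riemannian_lie_group G A g"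
    and "riemannian_lie_group H B h"
    and "lie_group_hom G A H B \<phi>"
  shows "(bi_invariant G A g \<and> submersion A B \<phi> \<longrightarrow> harmonic A g B h \<phi>) \<and>
    (bi_invariant H B h \<longrightarrow>
       biharmonic A g B h \<phi> \<and> (unimodular G A \<longrightarrow> harmonic A g B h \<phi>))"
proof -
  interpret riemannian_lie_group_hom G A g H B h \<phi>
    by unfold_locales (rule assms)+
  show ?thesis
    using harmonic_submersion harmonic_unimodular biharmonic_bi_invariant by blast
qed

end
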